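(* Let $\mathbb{K}$ be an algebraically closed field of characteristic zero and let $X$ be an irreducible algebraic variety over $\mathbb{K}$. Then: (1) any two additive actions on $X$ are conjugate in the group $\mathrm{Bir}(X)$; (2) if two additive actions on $X$ have the same open orbit $U$ in $X$, then these actions are conjugate in the group $\mathrm{Aut}(U)\subseteq\mathrm{Bir}(X)$ (the affine Cremona group).
   Context: $\mathbb{G}_a=(\mathbb{K},+)$ denotes the additive group of $\mathbb{K}$. An additive action on an irreducible algebraic variety $X$ is an effective regular action $\mathbb{G}_a^n\times X\to X$ with an open orbit (so necessarily $n=\dim X$). $\mathrm{Aut}(X)$ is the group of regular automorphisms of $X$ and $\mathrm{Bir}(X)$ is the group of birational automorphisms of $X$. For a nonempty open subset $U\subseteq X$, a regular automorphism of $U$ is viewed as a birational automorphism of $X$, so $\mathrm{Aut}(U)\subseteq\mathrm{Bir}(X)$. The open orbit $U$ of an additive action is isomorphic to the affine space $\mathbb{A}^n$, and $\mathrm{Aut}(U)\cong\mathrm{Aut}(\mathbb{A}^n)$ is called the affine Cremona group. Two additive actions $(g,x)\mapsto g\circ x$ and $(g,x)\mapsto g*x$ of $\mathbb{G}_a^n$ on $X$ are conjugate in $\mathrm{Bir}(X)$ if there is $\psi\in\mathrm{Bir}(X)$ such that, for every $g\in\mathbb{G}_a^n$, $\psi(g\circ x)=g*\psi(x)$ as rational maps in $x$. If both actions have the open orbit $U$, they are conjugate in $\mathrm{Aut}(U)$ if there is $\psi\in\mathrm{Aut}(U)$ with $\psi(g\circ x)=g*\psi(x)$ for all $g\in\mathbb{G}_a^n$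 and $x\in U$. *)

theory Defs
  imports
    "HOL-Analysis.Abstract_Topology"
    "HOL-Algebra.Group_Action"
    "HOL-Computational_Algebra.Polynomial"
    "Jordan_Normal_Form.Matrix"
begin

text \<open>
  Algebraic varieties over a field are rendered classically, as ``spaces with functions'': a
  topological space together with a sheaf of functions with values in the ground field. The
  value \<open>reg X U\<close> is only meaningful when \<open>U\<close> is open in \<open>X\<close>, and its elements are functions on the
  whole type of which only the values on \<open>U\<close> matter.
\<close>

record ('p, 'k) function_space =
  space_top :: "'p topology"
  reg :: "'p set \<Rightarrow> ('p \<Rightarrow> 'k) set"

definition points :: "('p, 'k, 'm) function_space_scheme \<Rightarrow> 'p set" where
  "points X = topspace (space_top X)"

text \<open>
  The axiom \<open>reg_local\<close> is the gluing axiom of sheaves; it also says that membership in \<open>reg X U\<close>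
  depends only on the values on \<open>U\<close>.
\<close>

locale space_with_functions =
  fixes X :: "('p, 'k :: field) function_space"
  assumes reg_const: "openin (space_top X) U \<Longrightarrow> (\<lambda>_. c) \<in> reg X U"
    and reg_add: "\<lbrakk>openin (space_top X) U; f \<in> reg X U; g \<in> reg X U\<rbrakk> \<Longrightarrow> (\<lambda>x. f x + g x) \<in> reg X U"
    and reg_mult: "\<lbrakk>openin (space_top X) U; f \<in> reg X U; g \<in> reg X U\<rbrakk> \<Longrightarrow> (\<lambda>x. f x * g x) \<in> reg X U"
    and open_nonzero: "\<lbrakk>openin (space_top X) U; f \<in> reg X U\<rbrakk>
          \<Longrightarrow> openin (space_top X) {x \<in> U. f x \<noteq> 0}"
    and reg_inverse: "\<lbrakk>openin (space_top X) U; f \<in> reg X U\<rbrakk>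
          \<Longrightarrow> (\<lambda>x. inverse (f x)) \<in> reg X {x \<in> U. f x \<noteq> 0}"
    and reg_restrict: "\<lbrakk>openin (space_top X) U; openin (space_top X) V; V \<subseteq> U; f \<in> reg X U\<rbrakk>
          \<Longrightarrow> f \<in> reg X V"
    and reg_local: "\<lbrakk>openin (space_top X) U;
            \<And>x. x \<in> U \<Longrightarrow> \<exists>V g. openin (space_top X) V \<and> x \<in> V \<and> V \<subseteq> U \<and> g \<in> reg X V \<and> (\<forall>y\<in>V. f y = g y)\<rbrakk>
          \<Longrightarrow> f \<in> reg X U"

definition morphism ::
  "('p, 'k) function_space \<Rightarrow> ('q, 'k) function_space \<Rightarrow> ('p \<Rightarrow> 'q) \<Rightarrow> bool" where
  "morphism X Y \<phi> \<longleftrightarrow>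
     continuous_map (space_top X) (space_top Y) \<phi> \<and>
     (\<forall>V f. openin (space_top Y) V \<longrightarrow> f \<in> reg Y V \<longrightarrow>
        (\<lambda>x. f (\<phi> x)) \<in> reg X {x \<in> points X. \<phi> x \<in> V})"

definition isomorphism ::
  "('p, 'k) function_space \<Rightarrow> ('q, 'k) function_space \<Rightarrow> ('p \<Rightarrow> 'q) \<Rightarrow> bool" where
  "isomorphism X Y \<phi> \<longleftrightarrow> morphism X Y \<phi> \<and>
     (\<exists>\<psi>. morphism Y X \<psi> \<and> (\<forall>x\<in>points X. \<psi> (\<phi> x) = x) \<and> (\<forall>y\<in>points Y. \<phi> (\<psi> y) = y))"

definition open_subspace :: "('p, 'k) function_space \<Rightarrow> 'p set \<Rightarrow> ('p, 'k) function_space" where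
  "open_subspace X U = \<lparr>space_top = subtopology (space_top X) U, reg = reg X\<rparr>"


text \<open>
  Polynomial functions on affine \<open>n\<close>-space, whose set of points is \<open>carrier_vec n\<close>.
\<close>

inductive polyfun :: "nat \<Rightarrow> ('k :: field vec \<Rightarrow> 'k) \<Rightarrow> bool" for n where
  const: "polyfun n (\<lambda>_. c)"
| coord: "i < n \<Longrightarrow> polyfun n (\<lambda>v. v $ i)"
| add: "polyfun n p \<Longrightarrow> polyfun n q \<Longrightarrow> polyfun n (\<lambda>v. p v + q v)"
| mult: "polyfun n p \<Longrightarrow> polyfun n q \<Longrightarrow> polyfun n (\<lambda>v. p v * q v)"

definition zero_locus :: "nat \<Rightarrow> ('k :: field vec \<Rightarrow> 'k) set \<Rightarrow> 'k vec set" where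
  "zero_locus n S = {v \<in> carrier_vec n. \<forall>p\<in>S. p v = 0}"

definition algebraic_set :: "nat \<Rightarrow> 'k :: field vec set \<Rightarrow> bool" where
  "algebraic_set n Z \<longleftrightarrow> (\<exists>S. S \<subseteq> Collect (polyfun n) \<and> Z = zero_locus n S)"

text \<open>The topology whose closed sets are the algebraic sets; see \<open>closedin_zariski\<close> below.\<close>

definition zariski :: "nat \<Rightarrow> 'k :: field vec topology" where
  "zariski n = topology (\<lambda>U. U \<subseteq> carrier_vec n \<and> algebraic_set n (carrier_vec n - U))"

definition affine_structure :: "nat \<Rightarrow> 'k :: field vec set \<Rightarrow> ('k vec, 'k) function_space" where
  "affine_structure n Z =
     \<lparr>space_top = subtopology (zariski n) Z,
      reg = (\<lambda>U. {f. \<forall>x\<in>U. \<exists>V p q. openin (subtopology (zariski n) Z) V \<and> x \<in> V \<and> V \<subseteq> U \<and>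
                       polyfun n p \<and> polyfun n q \<and> (\<forall>y\<in>V. q y \<noteq> 0 \<and> f y = p y / q y)})\<rparr>"

definition affine_space :: "nat \<Rightarrow> ('k :: field vec, 'k) function_space" where
  "affine_space n = affine_structure n (carrier_vec n)"


text \<open>
  The product of two spaces with functions: a basis of the topology is given by the sets
  \<open>{(x, y) \<in> U \<times> V. h (x, y) \<noteq> 0}\<close> with \<open>h = (\<Sum>i. f\<^sub>i \<otimes> g\<^sub>i)\<close>, where the \<open>f\<^sub>i\<close> are regular on \<open>U\<close> and
  the \<open>g\<^sub>i\<close> on \<open>V\<close>; the regular functions are locally quotients of such functions. For varieties this
  is the product variety, and it is in general finer than the product topology.
\<close>

definition tensor_functions ::
  "('p, 'k :: field) function_space \<Rightarrow> ('q, 'k) function_space \<Rightarrow> 'p set \<Rightarrow> 'q set \<Rightarrow> ('p \<times> 'q \<Rightarrow> 'k) set" where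
  "tensor_functions X Y U V =
     {h. \<exists>(r::nat) f g. (\<forall>i<r. f i \<in> reg X U \<and> g i \<in> reg Y V) \<and>
                        h = (\<lambda>(x, y). \<Sum>i<r. f i x * g i y)}"

definition product_space ::
  "('p, 'k :: field) function_space \<Rightarrow> ('q, 'k) function_space \<Rightarrow> ('p \<times> 'q, 'k) function_space" where
  "product_space X Y =
     \<lparr>space_top = topology_generated_by
        {{z \<in> U \<times> V. h z \<noteq> 0} | U V h. openin (space_top X) U \<and> openin (space_top Y) V \<and>
                                      h \<in> tensor_functions X Y U V},
      reg = (\<lambda>W. {f. \<forall>z\<in>W. \<exists>U V h k. openin (space_top X) U \<and> openin (space_top Y) V \<and>
               h \<in> tensor_functions X Y U V \<and> k \<in> tensor_functions X Y U V \<and>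
               z \<in> {w \<in> U \<times> V. k w \<noteq> 0} \<and> {w \<in> U \<times> V. k w \<noteq> 0} \<subseteq> W \<and>
               (\<forall>w\<in>{w \<in> U \<times> V. k w \<noteq> 0}. f w = h w / k w)})\<rparr>"

definition prevariety :: "('p, 'k :: field) function_space \<Rightarrow> bool" where
  "prevariety X \<longleftrightarrow> space_with_functions X \<and>
     (\<exists>\<U>. finite \<U> \<and> \<Union>\<U> = points X \<and>
        (\<forall>U\<in>\<U>. openin (space_top X) U \<and>
           (\<exists>m Z \<phi>. algebraic_set m Z \<and> isomorphism (open_subspace X U) (affine_structure m Z) \<phi>)))"

definition variety :: "('p, 'k :: field) function_space \<Rightarrow> bool" where
  "variety X \<longleftrightarrow> prevariety X \<and>
     closedin (space_top (product_space X X)) {(x, x) | x. x \<in> points X}"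

definition irreducible_space :: "'p topology \<Rightarrow> bool" where
  "irreducible_space T \<longleftrightarrow> topspace T \<noteq> {} \<and>
     (\<forall>A B. closedin T A \<and> closedin T B \<and> A \<union> B = topspace T \<longrightarrow> A = topspace T \<or> B = topspace T)"

definition irreducible_variety :: "('p, 'k :: field) function_space \<Rightarrow> bool" where
  "irreducible_variety X \<longleftrightarrow> variety X \<and> irreducible_space (space_top X)"


text \<open>
  Rational maps between irreducible varieties are represented by a nonempty (hence dense) open
  domain together with a morphism on it; two representatives are the same rational map iff they are
  related by \<open>rat_eq\<close>. Thus \<open>Bir X\<close> is the set of representatives of the elements of the group of
  birational automorphisms, whose multiplication is \<open>rat_comp\<close> up to \<open>rat_eq\<close>.
\<close>

type_synonym ('p, 'q) partial_map = "'p set \<times> ('p \<Rightarrow> 'q)"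

definition rational_map ::
  "('p, 'k) function_space \<Rightarrow> ('q, 'k) function_space \<Rightarrow> ('p, 'q) partial_map \<Rightarrow> bool" where
  "rational_map X Y r \<longleftrightarrow> openin (space_top X) (fst r) \<and> fst r \<noteq> {} \<and>
     morphism (open_subspace X (fst r)) Y (snd r)"

definition dominant :: "('q, 'k) function_space \<Rightarrow> ('p, 'q) partial_map \<Rightarrow> bool" where
  "dominant Y r \<longleftrightarrow> Abstract_Topology.closure_of (space_top Y) (snd r ` fst r) = points Y"

definition rat_eq ::
  "('p, 'k) function_space \<Rightarrow> ('p, 'q) partial_map \<Rightarrow> ('p, 'q) partial_map \<Rightarrow> bool" where
  "rat_eq X r s \<longleftrightarrow> (\<exists>W. openin (space_top X) W \<and> W \<noteq> {} \<and> W \<subseteq> fst r \<inter> fst s \<and>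
     (\<forall>x\<in>W. snd r x = snd s x))"

definition rat_comp ::
  "('q, 'r) partial_map \<Rightarrow> ('p, 'q) partial_map \<Rightarrow> ('p, 'r) partial_map" where
  "rat_comp s r = ({x \<in> fst r. snd r x \<in> fst s}, \<lambda>x. snd s (snd r x))"

definition rat_of :: "('p, 'k) function_space \<Rightarrow> ('p \<Rightarrow> 'q) \<Rightarrow> ('p, 'q) partial_map" where
  "rat_of X f = (points X, f)"

definition Bir :: "('p, 'k) function_space \<Rightarrow> ('p, 'p) partial_map set" where
  "Bir X = {r. rational_map X X r \<and> dominant X r \<and>
     (\<exists>s. rational_map X X s \<and> dominant X s \<and>
          rat_eq X (rat_comp s r) (rat_of X (\<lambda>x. x)) \<and> rat_eq X (rat_comp r s) (rat_of X (\<lambda>x. x)))}"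

definition Aut :: "('p, 'k) function_space \<Rightarrow> ('p \<Rightarrow> 'p) set" where
  "Aut X = {\<phi>. isomorphism X X \<phi>}"


text \<open>
  The additive group of \<open>'k\<^sup>n\<close> is \<open>monoid_vec\<close>. The locale \<open>faithful_action\<close> is effectivity of the
  action; it also fixes the irrelevant values of \<open>\<alpha> g\<close> outside \<open>points X\<close> to be \<open>undefined\<close>.
\<close>

abbreviation Ga :: "'k itself \<Rightarrow> nat \<Rightarrow> ('k :: field vec) monoid" where
  "Ga \<equiv> monoid_vec"

definition open_orbit ::
  "nat \<Rightarrow> ('p, 'k :: field) function_space \<Rightarrow> ('k vec \<Rightarrow> 'p \<Rightarrow> 'p) \<Rightarrow> 'p set \<Rightarrow> bool" where
  "open_orbit n X \<alpha> U \<longleftrightarrow>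
     U \<in> orbits (Ga TYPE('k) n) (points X) \<alpha> \<and> openin (space_top X) U"

definition additive_action ::
  "nat \<Rightarrow> ('p, 'k :: field) function_space \<Rightarrow> ('k vec \<Rightarrow> 'p \<Rightarrow> 'p) \<Rightarrow> bool" where
  "additive_action n X \<alpha> \<longleftrightarrow>
     faithful_action (Ga TYPE('k) n) (points X) \<alpha> \<and>
     morphism (product_space (affine_space n) X) X (\<lambda>(g, x). \<alpha> g x) \<and>
     (\<exists>U. open_orbit n X \<alpha> U)"

definition conjugate_in_Bir ::
  "nat \<Rightarrow> ('p, 'k :: field) function_space \<Rightarrow> ('k vec \<Rightarrow> 'p \<Rightarrow> 'p) \<Rightarrow> ('k vec \<Rightarrow> 'p \<Rightarrow> 'p) \<Rightarrow> bool" where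
  "conjugate_in_Bir n X \<alpha> \<beta> \<longleftrightarrow>
     (\<exists>\<psi>\<in>Bir X. \<forall>g\<in>carrier (Ga TYPE('k) n).
        rat_eq X (rat_comp \<psi> (rat_of X (\<alpha> g))) (rat_comp (rat_of X (\<beta> g)) \<psi>))"

definition conjugate_in_Aut ::
  "nat \<Rightarrow> ('p, 'k :: field) function_space \<Rightarrow> 'p set \<Rightarrow> ('k vec \<Rightarrow> 'p \<Rightarrow> 'p) \<Rightarrow> ('k vec \<Rightarrow> 'p \<Rightarrow> 'p) \<Rightarrow> bool" where
  "conjugate_in_Aut n X U \<alpha> \<beta> \<longleftrightarrow>
     (\<exists>\<psi>\<in>Aut (open_subspace X U). \<forall>g\<in>carrier (Ga TYPE('k) n). \<forall>x\<in>U. \<psi> (\<alpha> g x) = \<beta> g (\<psi> x))"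


lemma algebraic_set_Un:
  fixes A B :: "'k :: field vec set"
  assumes "algebraic_set n A" "algebraic_set n B"
  shows "algebraic_set n (A \<union> B)"
proof -
  obtain S where S: "S \<subseteq> Collect (polyfun n)" "A = zero_locus n S"
    using assms(1) unfolding algebraic_set_def by (elim exE conjE)
  obtain T where T: "T \<subseteq> Collect (polyfun n)" "B = zero_locus n T"
    using assms(2) unfolding algebraic_set_def by (elim exE conjE)
  let ?P = "(\<lambda>(p, q) v. p v * q v) ` (S \<times> T)"
  have mem: "v \<in> zero_locus n ?P \<longleftrightarrow> v \<in> carrier_vec n \<and> (\<forall>p\<in>S. \<forall>q\<in>T. p v * q v = 0)" for v
    unfolding zero_locus_def by simp
  have "v \<in> A \<union> B \<longleftrightarrow> v \<in> zero_locus n ?P" for v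
    unfolding mem mult_eq_0_iff S(2) T(2) by (auto simp: zero_locus_def)
  then have "A \<union> B = zero_locus n ?P" by (intro Set.set_eqI)
  moreover have "?P \<subseteq> Collect (polyfun n)"
  proof
    fix h assume "h \<in> ?P"
    then obtain p q where h: "h = (\<lambda>v. p v * q v)" and pq: "p \<in> S" "q \<in> T" by (elim imageE) auto
    have "polyfun n p" "polyfun n q" using subsetD[OF S(1) pq(1)] subsetD[OF T(1) pq(2)] by simp_all
    then show "h \<in> Collect (polyfun n)" unfolding h mem_Collect_eq by (rule polyfun.mult)
  qed
  ultimately show ?thesis unfolding algebraic_set_def by (intro exI conjI)
qed

lemma algebraic_set_carrier: "algebraic_set n (carrier_vec n)"
  unfolding algebraic_set_def zero_locus_def by (rule exI[of _ "{}"]) simp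

lemma algebraic_set_empty: "algebraic_set n {}"
  unfolding algebraic_set_def zero_locus_def
  by (rule exI[of _ "{\<lambda>_. 1}"]) (simp add: polyfun.const)

lemma algebraic_set_INT:
  fixes \<A> :: "'k :: field vec set set"
  assumes "\<And>A. A \<in> \<A> \<Longrightarrow> algebraic_set n A"
  shows "algebraic_set n (carrier_vec n \<inter> \<Inter>\<A>)"
proof -
  obtain S where S: "\<And>A. A \<in> \<A> \<Longrightarrow> S A \<subseteq> Collect (polyfun n) \<and> A = zero_locus n (S A)"
    using assms unfolding algebraic_set_def by metis
  have "carrier_vec n \<inter> \<Inter>\<A> = zero_locus n (\<Union>A\<in>\<A>. S A)"
  proof (rule Set.set_eqI)
    fix v
    have "(\<forall>A\<in>\<A>. v \<in> A) \<longleftrightarrow> (\<forall>A\<in>\<A>. v \<in> zero_locus n (S A))" using S by blast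
    then show "v \<in> carrier_vec n \<inter> \<Inter>\<A> \<longleftrightarrow> v \<in> zero_locus n (\<Union>A\<in>\<A>. S A)"
      unfolding zero_locus_def by auto
  qed
  moreover have "(\<Union>A\<in>\<A>. S A) \<subseteq> Collect (polyfun n)" using S by blast
  ultimately show ?thesis unfolding algebraic_set_def by (intro exI conjI)
qed

lemma openin_zariski:
  fixes U :: "'a :: field vec set"
  shows "openin (zariski n) U \<longleftrightarrow> U \<subseteq> carrier_vec n \<and> algebraic_set n (carrier_vec n - U)"
proof -
  have "istopology (\<lambda>U :: 'a vec set. U \<subseteq> carrier_vec n \<and> algebraic_set n (carrier_vec n - U))"
    unfolding istopology_def
  proof (intro conjI allI impI)
    fix U V :: "'a vec set"
    assume U: "U \<subseteq> carrier_vec n \<and> algebraic_set n (carrier_vec n - U)"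
      and V: "V \<subseteq> carrier_vec n \<and> algebraic_set n (carrier_vec n - V)"
    show "U \<inter> V \<subseteq> carrier_vec n" using U by blast
    have "carrier_vec n - U \<inter> V = (carrier_vec n - U) \<union> (carrier_vec n - V)" by blast
    then show "algebraic_set n (carrier_vec n - U \<inter> V)" using U V by (simp only: algebraic_set_Un)
  next
    fix \<K> :: "'a vec set set"
    assume K: "\<forall>U\<in>\<K>. U \<subseteq> carrier_vec n \<and> algebraic_set n (carrier_vec n - U)"
    show "\<Union>\<K> \<subseteq> carrier_vec n" using K by blast
    have "carrier_vec n - \<Union>\<K> = carrier_vec n \<inter> \<Inter>((\<lambda>U. carrier_vec n - U) ` \<K>)" by blast
    then show "algebraic_set n (carrier_vec n - \<Union>\<K>)"
      by (simp only:, intro algebraic_set_INT) (elim imageE, simp only: K[rule_format])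
  qed
  then show ?thesis unfolding zariski_def by (simp add: topology_inverse')
qed

lemma topspace_zariski: "topspace (zariski n :: 'k :: field vec topology) = carrier_vec n"
proof
  have "openin (zariski n) (topspace (zariski n) :: 'k vec set)" by (rule openin_topspace)
  then show "topspace (zariski n :: 'k vec topology) \<subseteq> carrier_vec n" by (simp only: openin_zariski)
  show "carrier_vec n \<subseteq> topspace (zariski n :: 'k vec topology)"
    by (rule openin_subset) (simp add: openin_zariski algebraic_set_empty)
qed

lemma closedin_zariski: "closedin (zariski n) Z \<longleftrightarrow> algebraic_set n Z"
proof -
  have "Z \<subseteq> carrier_vec n" if "algebraic_set n Z"
    using that unfolding algebraic_set_def by (elim exE conjE) (simp add: zero_locus_def)
  moreover have "carrier_vec n - (carrier_vec n - Z) = Z" if "Z \<subseteq> carrier_vec n"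
    using that by blast
  ultimately show ?thesis
    unfolding closedin_def openin_zariski topspace_zariski by (metis Diff_subset)
qed

text \<open>The inclusion of \<open>Aut U\<close> in \<open>Bir X\<close> for a nonempty open subset \<open>U\<close>.\<close>

lemma Aut_open_subspace_Bir:
  assumes X: "irreducible_variety X" and U: "openin (space_top X) U" "U \<noteq> {}"
    and \<psi>: "\<psi> \<in> Aut (open_subspace X U)"
  shows "(U, \<psi>) \<in> Bir X"
proof -
  interpret space_with_functions X
    using X unfolding irreducible_variety_def variety_def prevariety_def by blast
  have sub: "U \<subseteq> points X" using U(1) unfolding points_def by (rule openin_subset)
  then have top: "points (open_subspace X U) = U"
    unfolding points_def open_subspace_def by (auto simp: topspace_subtopology)
  obtain \<chi> where m: "morphism (open_subspace X U) (open_subspace X U) \<psi>"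
      "morphism (open_subspace X U) (open_subspace X U) \<chi>"
    and inv: "\<And>x. x \<in> U \<Longrightarrow> \<chi> (\<psi> x) = x" "\<And>x. x \<in> U \<Longrightarrow> \<psi> (\<chi> x) = x"
    using \<psi> unfolding Aut_def isomorphism_def top by auto
  have maps: "\<phi> x \<in> U" if "morphism (open_subspace X U) (open_subspace X U) \<phi>" "x \<in> U" for \<phi> x
    using that top unfolding morphism_def continuous_map_def points_def by auto
  have rat: "rational_map X X (U, \<phi>)" if \<phi>: "morphism (open_subspace X U) (open_subspace X U) \<phi>" for \<phi>
  proof -
    have "continuous_map (space_top (open_subspace X U)) (space_top X) \<phi>"
      using \<phi> unfolding morphism_def open_subspace_def by (simp add: continuous_map_in_subtopology)
    moreover have "(\<lambda>x. f (\<phi> x)) \<in> reg (open_subspace X U) {x \<in> U. \<phi> x \<in> V}"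
      if V: "openin (space_top X) V" and f: "f \<in> reg X V" for V f
    proof -
      have o: "openin (space_top X) (V \<inter> U)" using V U(1) by (rule openin_Int)
      have "f \<in> reg X (V \<inter> U)" using reg_restrict[OF V o _ f] by blast
      moreover have "openin (subtopology (space_top X) U) (V \<inter> U)"
        using V openin_subtopology by blast
      ultimately have "(\<lambda>x. f (\<phi> x)) \<in> reg (open_subspace X U) {x \<in> U. \<phi> x \<in> V \<inter> U}"
        using \<phi>[unfolded morphism_def top, THEN conjunct2, rule_format, of "V \<inter> U" f]
        by (simp only: open_subspace_def function_space.simps)
      moreover have "{x \<in> U. \<phi> x \<in> V \<inter> U} = {x \<in> U. \<phi> x \<in> V}" using maps[OF \<phi>] by blast
      ultimately show ?thesis by simp
    qed
    ultimately show ?thesis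
      unfolding rational_map_def fst_conv snd_conv morphism_def top using U by blast
  qed
  have dense: "Abstract_Topology.closure_of (space_top X) U = points X"
  proof -
    let ?A = "Abstract_Topology.closure_of (space_top X) U" and ?B = "topspace (space_top X) - U"
    have "closedin (space_top X) ?B" using U(1) by (simp only: openin_closedin_eq)
    moreover have "?A \<union> ?B = topspace (space_top X)"
      using closure_of_subset[of U "space_top X"] closure_of_subset_topspace[of "space_top X" U]
        sub[unfolded points_def] by blast
    ultimately have "?A = topspace (space_top X) \<or> ?B = topspace (space_top X)"
      using X[unfolded irreducible_variety_def irreducible_space_def] closedin_closure_of[of "space_top X" U]
      by metis
    then show ?thesis using U(2) sub unfolding points_def by blast
  qed
  have "\<psi> ` U = U"
  proof
    show "\<psi> ` U \<subseteq> U" using maps[OF m(1)] by blast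
    show "U \<subseteq> \<psi> ` U"
    proof
      fix x assume x: "x \<in> U"
      show "x \<in> \<psi> ` U" by (rule image_eqI[of _ _ "\<chi> x"]) (simp_all add: x inv maps[OF m(2)])
    qed
  qed
  moreover have "\<chi> ` U = U"
  proof
    show "\<chi> ` U \<subseteq> U" using maps[OF m(2)] by blast
    show "U \<subseteq> \<chi> ` U"
    proof
      fix x assume x: "x \<in> U"
      show "x \<in> \<chi> ` U" by (rule image_eqI[of _ _ "\<psi> x"]) (simp_all add: x inv maps[OF m(1)])
    qed
  qed
  ultimately have dom: "dominant X (U, \<psi>)" "dominant X (U, \<chi>)"
    unfolding dominant_def by (simp_all add: dense)
  have "rat_eq X (rat_comp (U, g) (U, f)) (rat_of X (\<lambda>x. x))"
    if "\<And>x. x \<in> U \<Longrightarrow> f x \<in> U" "\<And>x. x \<in> U \<Longrightarrow> g (f x) = x" for f g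
    unfolding rat_eq_def rat_comp_def rat_of_def fst_conv snd_conv
    by (rule exI[of _ U]) (use U sub that in auto)
  from this[OF maps[OF m(1)] inv(1)] this[OF maps[OF m(2)] inv(2)]
  show ?thesis unfolding Bir_def using rat[OF m(1)] rat[OF m(2)] dom by blast
qed

end

theory Submission
  imports Defs
begin

text \<open>
  Let \<open>x0\<close> be a point of the open orbit \<open>U\<close> of an additive action \<open>\<alpha>\<close>. Everything follows once the
  orbit map \<open>g \<mapsto> \<alpha> g x0\<close> is known to be an isomorphism of \<open>K\<^sup>n\<close> with \<open>U\<close>: if \<open>y0\<close> is a point of the
  open orbit \<open>V\<close> of \<open>\<beta>\<close>, then \<open>\<alpha> g x0 \<mapsto> \<beta> g y0\<close> is an equivariant isomorphism \<open>U \<rightarrow> V\<close>. It is a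
  birational map of \<open>X\<close>, and an automorphism of \<open>U\<close> if \<open>U = V\<close>.

  The orbit map is a bijection onto \<open>U\<close> by commutativity, separatedness and faithfulness
  (\<open>stabilizer_trivial\<close>). The point is that its inverse \<open>\<tau>\<close> is regular. The usual argument is that a
  bijective morphism is birational in characteristic zero and that a homogeneous space is normal; the
  proof below uses the group structure instead and is elementary. Let \<open>R\<close> be the algebra of those
  polynomials \<open>h\<close> on \<open>K\<^sup>n\<close> for which \<open>h \<circ> \<tau>\<close> is regular on \<open>U\<close> (\<open>orbit_algebra\<close>); it is
  invariant under translations, as \<open>U\<close> is invariant under the action. The claim is that \<open>R\<close> contains
  the coordinate functions.

  \<^item> \<open>R\<close> is large. For a regular function \<open>F\<close> near \<open>x0\<close>, the function \<open>F (\<alpha> s u)\<close> is a quotient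
    \<open>A s u / B s u\<close>, polynomial in \<open>s\<close> and regular in \<open>u\<close>, because the action is a morphism on the
    product. Write \<open>A s x0 / B s x0 = p s / q s\<close> with \<open>q\<close> of least degree. For \<open>u\<close> near \<open>x0\<close> the
    translates of \<open>p\<close> and \<open>q\<close> by \<open>\<tau> u\<close> satisfy \<open>p (s + \<tau> u) * B s u = q (s + \<tau> u) * A s u\<close>, and \<open>q\<close>
    and its translate have the same leading form. By minimality these conditions determine the
    translates, so their coefficients solve a uniquely solvable linear system whose coefficients
    are regular in \<open>u\<close>; hence they are regular in \<open>u\<close> themselves (\<open>linear_system_regular\<close>). So \<open>p\<close>
    and \<open>q\<close> lie in \<open>R\<close> (\<open>coordinate_fraction\<close>). Applied to the coordinates of an affine chart, this
    shows that no nonzero vector is a period of all of \<open>R\<close> (\<open>orbit_algebra_periods\<close>).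

  \<^item> In characteristic zero, a translation invariant algebra of polynomials without common periods
    contains all coordinate functions (\<open>translation_invariant_algebra_coordinates\<close>). The reason is
    that differences lower the degree, so that by induction a common zero of the linear forms in
    the algebra is a period of all its elements.
\<close>

section \<open>Polynomial functions\<close>

lemma polyfun_uminus: "polyfun n p \<Longrightarrow> polyfun n (\<lambda>v. - p v)"
  using polyfun.mult[OF polyfun.const[of n "-1"], of p] by simp

lemma polyfun_diff: "polyfun n p \<Longrightarrow> polyfun n q \<Longrightarrow> polyfun n (\<lambda>v. p v - q v)"
  using polyfun.add[of n p "\<lambda>v. - q v"] by (simp add: polyfun_uminus)

lemma polyfun_sum: "(\<And>i. i \<in> I \<Longrightarrow> polyfun n (p i)) \<Longrightarrow> polyfun n (\<lambda>v. \<Sum>i\<in>I. p i v)"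
  by (induction I rule: infinite_finite_induct) (auto intro: polyfun.intros)

lemma polyfun_translate:
  assumes "polyfun n p" "g \<in> carrier_vec n"
  shows "polyfun n (\<lambda>v. p (v + g))"
  using assms(1)
proof induction
  case (coord i)
  then have "(\<lambda>v. (v + g) $ i) = (\<lambda>v. v $ i + g $ i)" using assms(2) by auto
  then show ?case using coord by (auto intro: polyfun.intros)
qed (auto intro: polyfun.intros)

lemma polyfun_line:
  assumes "polyfun n p" "a \<in> carrier_vec n" "v \<in> carrier_vec n"
  shows "\<exists>P. \<forall>c. p (a + c \<cdot>\<^sub>v v) = poly P c"
  using assms(1)
proof induction
  case (const c)
  show ?case by (rule exI[of _ "[:c:]"]) simp
next
  case (coord i)
  show ?case by (rule exI[of _ "[:a $ i, v $ i:]"]) (use coord assms(2,3) in auto)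
next
  case (add p q)
  then obtain P Q where "\<forall>c. p (a + c \<cdot>\<^sub>v v) = poly P c" "\<forall>c. q (a + c \<cdot>\<^sub>v v) = poly Q c" by auto
  then show ?case by (intro exI[of _ "P + Q"]) simp
next
  case (mult p q)
  then obtain P Q where "\<forall>c. p (a + c \<cdot>\<^sub>v v) = poly P c" "\<forall>c. q (a + c \<cdot>\<^sub>v v) = poly Q c" by auto
  then show ?case by (intro exI[of _ "P * Q"]) simp
qed

text \<open>Two nonempty open sets of affine space meet: on the line through a point of the one and a point
  of the other, either condition excludes only finitely many points.\<close>

lemma polyfun_nonzero_both:
  fixes p q :: "'k :: field_char_0 vec \<Rightarrow> 'k"
  assumes "polyfun n p" "polyfun n q"
    and a: "a \<in> carrier_vec n" "p a \<noteq> 0" and b: "b \<in> carrier_vec n" "q b \<noteq> 0"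
  shows "\<exists>s\<in>carrier_vec n. p s \<noteq> 0 \<and> q s \<noteq> 0"
proof -
  have v: "b - a \<in> carrier_vec n" using a b by simp
  obtain P where P: "\<And>c. p (a + c \<cdot>\<^sub>v (b - a)) = poly P c"
    using polyfun_line[OF assms(1) a(1) v] by blast
  obtain Q where Q: "\<And>c. q (a + c \<cdot>\<^sub>v (b - a)) = poly Q c"
    using polyfun_line[OF assms(2) a(1) v] by blast
  have "a + 0 \<cdot>\<^sub>v (b - a) = a" "a + 1 \<cdot>\<^sub>v (b - a) = b" using a b by auto
  then have "poly P 0 \<noteq> 0" "poly Q 1 \<noteq> 0" using a b by (simp_all flip: P Q)
  then have "P * Q \<noteq> 0" by auto
  then have "finite {c. poly (P * Q) c = 0}" by (rule poly_roots_finite)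
  then obtain c where "poly (P * Q) c \<noteq> 0"
    using infinite_UNIV_char_0[where 'a='k] ex_new_if_finite by blast
  then have "p (a + c \<cdot>\<^sub>v (b - a)) \<noteq> 0 \<and> q (a + c \<cdot>\<^sub>v (b - a)) \<noteq> 0" by (simp add: P Q)
  then show ?thesis using a b by (intro bexI[of _ "a + c \<cdot>\<^sub>v (b - a)"]) auto
qed

lemma polyfun_nonzero_all:
  fixes p :: "'i \<Rightarrow> 'k :: field_char_0 vec \<Rightarrow> 'k"
  assumes "finite I"
    and "\<And>i. i \<in> I \<Longrightarrow> polyfun n (p i)" "\<And>i. i \<in> I \<Longrightarrow> \<exists>s\<in>carrier_vec n. p i s \<noteq> 0"
  shows "\<exists>r. polyfun n r \<and> (\<exists>s\<in>carrier_vec n. r s \<noteq> 0) \<and> (\<forall>s. r s \<noteq> 0 \<longrightarrow> (\<forall>i\<in>I. p i s \<noteq> 0))"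
  using assms
proof (induction I rule: finite_induct)
  case empty
  show ?case by (rule exI[of _ "\<lambda>_. 1"]) (auto intro!: polyfun.const exI[of _ "0\<^sub>v n"] simp: Bex_def)
next
  case (insert i I)
  then obtain r where r: "polyfun n r" "\<exists>s\<in>carrier_vec n. r s \<noteq> 0" "\<forall>s. r s \<noteq> 0 \<longrightarrow> (\<forall>i\<in>I. p i s \<noteq> 0)"
    by auto
  have i: "polyfun n (p i)" "\<exists>s\<in>carrier_vec n. p i s \<noteq> 0" using insert.prems by auto
  obtain s where "s \<in> carrier_vec n" "r s \<noteq> 0" "p i s \<noteq> 0"
    using r(2) i(2) polyfun_nonzero_both[OF r(1) i(1)] by blast
  then show ?case using r i by (intro exI[of _ "\<lambda>s. r s * p i s"]) (auto intro: polyfun.mult)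
qed

lemma polyfun_eqI:
  fixes p q r :: "'k :: field_char_0 vec \<Rightarrow> 'k"
  assumes "polyfun n p" "polyfun n q" "polyfun n r"
    and "\<exists>s\<in>carrier_vec n. r s \<noteq> 0"
    and eq: "\<And>s. s \<in> carrier_vec n \<Longrightarrow> r s \<noteq> 0 \<Longrightarrow> p s = q s"
    and s: "s \<in> carrier_vec n"
  shows "p s = q s"
proof (rule ccontr)
  assume "p s \<noteq> q s"
  then have "(\<lambda>v. p v - q v) s \<noteq> 0" by simp
  with polyfun_nonzero_both[OF polyfun_diff[OF assms(1,2)] assms(3)] assms(4) s eq show False
    by auto
qed

text \<open>The bound on the degree is strict, so that the filtration starts with the zero space at 0 and
  forming a difference lowers the bound by one.\<close>

inductive degree_less :: "nat \<Rightarrow> nat \<Rightarrow> ('k :: field vec \<Rightarrow> 'k) \<Rightarrow> bool" for n where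
  zero: "degree_less n d (\<lambda>_. 0)"
| const: "degree_less n (Suc d) (\<lambda>_. c)"
| coord: "i < n \<Longrightarrow> degree_less n d p \<Longrightarrow> degree_less n (Suc d) (\<lambda>v. v $ i * p v)"
| add: "degree_less n d p \<Longrightarrow> degree_less n d q \<Longrightarrow> degree_less n d (\<lambda>v. p v + q v)"

lemma degree_less_polyfun: "degree_less n d p \<Longrightarrow> polyfun n p"
  by (induction rule: degree_less.induct) (auto intro: polyfun.intros)

lemma degree_less_0: "degree_less n 0 p \<Longrightarrow> p v = 0"
  by (induction "0::nat" p rule: degree_less.induct) auto

lemma degree_less_scale: "degree_less n d p \<Longrightarrow> degree_less n d (\<lambda>v. c * p v)"
proof (induction rule: degree_less.induct)
  case (coord i d p)
  then have "degree_less n (Suc d) (\<lambda>v. v $ i * (c * p v))" by (intro degree_less.coord)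
  then show ?case by (simp add: ac_simps)
qed (auto simp: distrib_left intro: degree_less.intros)

lemma degree_less_mono: "degree_less n d p \<Longrightarrow> d \<le> e \<Longrightarrow> degree_less n e p"
proof (induction arbitrary: e rule: degree_less.induct)
  case (const d c)
  then show ?case by (cases e) (auto intro: degree_less.intros)
next
  case (coord i d p)
  then show ?case by (cases e) (auto intro: degree_less.intros)
qed (auto intro: degree_less.intros)

lemma degree_less_mult:
  "degree_less n a p \<Longrightarrow> degree_less n b q \<Longrightarrow> degree_less n (a + b) (\<lambda>v. p v * q v)"
proof (induction rule: degree_less.induct)
  case (const d c)
  then show ?case using degree_less_mono[OF degree_less_scale[OF const], of "Suc d + b" c] by simp
next
  case (coord i d p)
  then have "degree_less n (Suc (d + b)) (\<lambda>v. v $ i * (p v * q v))" by (intro degree_less.coord)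
  then show ?case by (simp add: ac_simps)
qed (auto simp: distrib_right intro: degree_less.intros)

lemma polyfun_degree_less: "polyfun n p \<Longrightarrow> \<exists>d. degree_less n d p"
proof (induction rule: polyfun.induct)
  case (coord i)
  have "degree_less n (Suc (Suc 0)) (\<lambda>v. v $ i * 1 :: 'a)"
    by (rule degree_less.coord[OF coord degree_less.const])
  then show ?case by auto
next
  case (add p q)
  then obtain a b where "degree_less n a p" "degree_less n b q" by auto
  then have "degree_less n (max a b) p" "degree_less n (max a b) q" by (auto intro: degree_less_mono)
  then show ?case by (blast intro: degree_less.add)
qed (blast intro: degree_less.const degree_less_mult)+

text \<open>Translations act trivially on the graded pieces of the filtration.\<close>

lemma degree_less_difference:
  assumes "degree_less n d p" "g \<in> carrier_vec n"
  shows "degree_less n (d - 1) (\<lambda>v. p (v + g) - p v)"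
  using assms(1)
proof induction
  case (coord i d p)
  let ?D = "\<lambda>v. p (v + g) - p v"
  have eq: "(\<lambda>v. (v + g) $ i * p (v + g) - v $ i * p v) = (\<lambda>v. v $ i * ?D v + g $ i * (?D v + p v))"
    using coord(1) assms(2) by (auto simp: algebra_simps)
  have "degree_less n d (\<lambda>v. v $ i * ?D v)"
  proof (cases d)
    case 0
    then have "p v = 0" for v using coord degree_less_0 by blast
    then show ?thesis by (simp add: degree_less.zero)
  next
    case (Suc e)
    then show ?thesis using degree_less.coord[OF coord(1,3)] by simp
  qed
  moreover have "degree_less n d (\<lambda>v. g $ i * (?D v + p v))"
    by (intro degree_less_scale degree_less.add coord degree_less_mono[OF coord(3)]) simp
  ultimately show ?case unfolding eq by (auto intro: degree_less.add)
next
  case (add d p q)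
  have "(\<lambda>v. p (v + g) + q (v + g) - (p v + q v)) = (\<lambda>v. (p (v + g) - p v) + (q (v + g) - q v))" by auto
  then show ?case using degree_less.add[OF add(3,4)] by simp
qed (auto intro: degree_less.intros)

lemma degree_less_translate:
  assumes "degree_less n d p" "g \<in> carrier_vec n"
  shows "degree_less n d (\<lambda>v. p (v + g))"
proof -
  have "degree_less n d (\<lambda>v. (p (v + g) - p v) + p v)"
    by (intro degree_less.add assms(1) degree_less_mono[OF degree_less_difference[OF assms]]) simp
  then show ?thesis by simp
qed

lemma degree_less_sum:
  assumes "\<And>i. i \<in> I \<Longrightarrow> degree_less n d (p i)"
  shows "degree_less n d (\<lambda>v. \<Sum>i\<in>I. p i v)"
  using assms
proof (induction I rule: infinite_finite_induct)
  case (insert i I)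
  then have "degree_less n d (\<lambda>v. p i v + (\<Sum>i\<in>I. p i v))" by (intro degree_less.add) auto
  then show ?case using insert.hyps by simp
qed (simp_all add: degree_less.zero)

section \<open>Interpolation\<close>

text \<open>A finite-dimensional space of functions is determined by the values at finitely many points: there
  are points of \<open>S\<close> with a dual basis of \<open>V\<close>, by which the functions in \<open>V\<close> are interpolated. The
  induction is on the size of a spanning family. Either the points found for the subspace spanned
  without the function \<open>b i\<close> suffice for \<open>V\<close>, or some interpolation error is nonzero at a point, which
  is then added.\<close>

lemma interpolation:
  fixes V :: "('s \<Rightarrow> 'k :: field) set"
  assumes "finite I"
    and "\<And>f g c. f \<in> V \<Longrightarrow> g \<in> V \<Longrightarrow> (\<lambda>x. f x + c * g x) \<in> V"
    and "\<And>f. f \<in> V \<Longrightarrow> \<exists>c. \<forall>x\<in>S. f x = (\<Sum>i\<in>I. c i * b i x)"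
  shows "\<exists>P l. finite P \<and> P \<subseteq> S \<and> (\<forall>p\<in>P. l p \<in> V) \<and> (\<forall>p\<in>P. \<forall>q\<in>P. l p q = (if p = q then 1 else 0)) \<and>
           (\<forall>f\<in>V. \<forall>x\<in>S. f x = (\<Sum>p\<in>P. f p * l p x))"
  using assms
proof (induction I arbitrary: V rule: finite_induct)
  case empty
  then show ?case by (intro exI[of _ "{}"]) auto
next
  case (insert i I)
  note closed = insert.prems(1)
  let ?W = "{f \<in> V. \<exists>c. \<forall>x\<in>S. f x = (\<Sum>j\<in>I. c j * b j x)}"
  have "\<exists>P l. finite P \<and> P \<subseteq> S \<and> (\<forall>p\<in>P. l p \<in> ?W) \<and>
           (\<forall>p\<in>P. \<forall>q\<in>P. l p q = (if p = q then 1 else 0)) \<and>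
           (\<forall>f\<in>?W. \<forall>x\<in>S. f x = (\<Sum>p\<in>P. f p * l p x))"
  proof (rule insert.IH)
    fix f g a assume "f \<in> ?W" "g \<in> ?W"
    then obtain c d where "f \<in> V" "g \<in> V" "\<forall>x\<in>S. f x = (\<Sum>j\<in>I. c j * b j x)" "\<forall>x\<in>S. g x = (\<Sum>j\<in>I. d j * b j x)"
      by blast
    moreover from this have "\<forall>x\<in>S. f x + a * g x = (\<Sum>j\<in>I. (c j + a * d j) * b j x)"
      by (simp add: distrib_right sum.distrib sum_distrib_left mult.assoc)
    ultimately show "(\<lambda>x. f x + a * g x) \<in> ?W"
      by (intro CollectI conjI closed exI[of _ "\<lambda>j. c j + a * d j"]) simp_all
  qed auto
  then obtain P l where Pl: "finite P \<and> P \<subseteq> S \<and> (\<forall>p\<in>P. l p \<in> ?W) \<and>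
           (\<forall>p\<in>P. \<forall>q\<in>P. l p q = (if p = q then 1 else 0)) \<and>
           (\<forall>f\<in>?W. \<forall>x\<in>S. f x = (\<Sum>p\<in>P. f p * l p x))" by (elim exE)
  then have P: "finite P" "P \<subseteq> S" "\<And>p. p \<in> P \<Longrightarrow> l p \<in> V"
    "\<And>p q. p \<in> P \<Longrightarrow> q \<in> P \<Longrightarrow> l p q = (if p = q then 1 else 0)" by blast+
  have W: "f x = (\<Sum>p\<in>P. f p * l p x)" if "f \<in> ?W" "x \<in> S" for f x
    using Pl that by blast
  have sumV: "(\<lambda>x. f x + (\<Sum>p\<in>Q. a p * l p x)) \<in> V" if "f \<in> V" "finite Q" "Q \<subseteq> P" for f a Q
    using that(2,3,1)
  proof (induction Q arbitrary: f rule: finite_induct)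
    case (insert p Q)
    then have "(\<lambda>x. (f x + (\<Sum>p\<in>Q. a p * l p x)) + a p * l p x) \<in> V"
      using P(3) by (intro closed) auto
    moreover have "(\<lambda>x. (f x + (\<Sum>p\<in>Q. a p * l p x)) + a p * l p x) = (\<lambda>x. f x + (\<Sum>p\<in>insert p Q. a p * l p x))"
      using insert.hyps by (auto simp: algebra_simps)
    ultimately show ?case by simp
  qed simp
  \<comment> \<open>the interpolation error of \<open>f\<close>\<close>
  define E where "E f = (\<lambda>x. f x + (\<Sum>p\<in>P. - f p * l p x))" for f
  have EV: "E f \<in> V" if "f \<in> V" for f unfolding E_def using sumV[OF that P(1), of "\<lambda>p. - f p"] by simp
  have EP: "E f p = 0" if "p \<in> P" for f p
  proof -
    have "(\<Sum>q\<in>P. - f q * l q p) = (\<Sum>q\<in>P. if q = p then - f q else 0)"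
      by (rule sum.cong) (use P(4) that in auto)
    then show ?thesis unfolding E_def using that P(1) by (simp add: sum.delta)
  qed
  show ?case
  proof (cases "\<forall>f\<in>V. \<forall>x\<in>S. E f x = 0")
    case True
    then have "\<forall>f\<in>V. \<forall>x\<in>S. f x = (\<Sum>p\<in>P. f p * l p x)"
      unfolding E_def by (auto simp: sum_negf eq_neg_iff_add_eq_0)
    then show ?thesis using P by (intro exI[of _ P] exI[of _ l] conjI ballI) blast+
  next
    case False
    then obtain f0 s where f0: "f0 \<in> V" "s \<in> S" "E f0 s \<noteq> 0" by blast
    have sP: "s \<notin> P" using EP f0(3) by blast
    \<comment> \<open>this is \<open>E f0\<close> divided by its value at \<open>s\<close>, in a form to which the closure property applies\<close>
    define e where "e = (\<lambda>x. E f0 x + (1 / E f0 s - 1) * E f0 x)"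
    have eV: "e \<in> V" unfolding e_def by (intro closed EV f0)
    have e: "e s = 1" "\<And>p. p \<in> P \<Longrightarrow> e p = 0"
      unfolding e_def using f0(3) EP by (auto simp: field_simps)
    define l' where "l' p = (if p = s then e else (\<lambda>x. l p x + (- l p s) * e x))" for p
    have "\<exists>a. \<forall>x\<in>S. f x = (\<Sum>p\<in>P. f p * l p x) + a * e x" if f: "f \<in> V" for f
    proof -
      obtain c where c: "\<And>x. x \<in> S \<Longrightarrow> f x = (\<Sum>j\<in>insert i I. c j * b j x)"
        using insert.prems(2)[OF f] by blast
      obtain d where d: "\<And>x. x \<in> S \<Longrightarrow> e x = (\<Sum>j\<in>insert i I. d j * b j x)"
        using insert.prems(2)[OF eV] by blast
      have "d i \<noteq> 0"
      proof
        assume "d i = 0"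
        then have "e \<in> ?W" using d insert.hyps eV by (auto intro!: exI[of _ d])
        then have "e s = (\<Sum>p\<in>P. e p * l p s)" using W f0 by blast
        then show False using e by simp
      qed
      define a where "a = c i / d i"
      then have ci: "c i = a * d i" using \<open>d i \<noteq> 0\<close> by simp
      have "(\<lambda>x. f x + (- a) * e x) \<in> ?W"
      proof -
        have "f x + (- a) * e x = (\<Sum>j\<in>I. (c j - a * d j) * b j x)" if "x \<in> S" for x
          using c[OF that] d[OF that] insert.hyps ci
          by (simp add: algebra_simps sum_subtractf sum_distrib_left sum_negf)
        then show ?thesis
          by (intro CollectI conjI closed[OF f eV] exI[of _ "\<lambda>j. c j - a * d j"] ballI)
      qed
      from W[OF this] have "f x + (- a) * e x = (\<Sum>p\<in>P. (f p + (- a) * e p) * l p x)" if "x \<in> S" for x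
        using that by simp
      then have "f x = (\<Sum>p\<in>P. f p * l p x) + a * e x" if "x \<in> S" for x
        using that e by (simp add: algebra_simps)
      then show ?thesis by blast
    qed
    then obtain a where a: "\<And>f x. f \<in> V \<Longrightarrow> x \<in> S \<Longrightarrow> f x = (\<Sum>p\<in>P. f p * l p x) + a f * e x" by metis
    have rep: "f x = (\<Sum>p\<in>insert s P. f p * l' p x)" if f: "f \<in> V" and x: "x \<in> S" for f x
    proof -
      have "(\<Sum>p\<in>P. f p * l' p x) = (\<Sum>p\<in>P. f p * l p x) - (\<Sum>p\<in>P. f p * l p s) * e x"
        using sP unfolding l'_def
        by (subst sum_distrib_right, subst sum_subtractf[symmetric], intro sum.cong) (auto simp: algebra_simps)
      then show ?thesis
        using a[OF f x] a[OF f f0(2)] e P(1) sP by (simp add: l'_def algebra_simps)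
    qed
    have "l' p \<in> V" if "p \<in> insert s P" for p
      using that eV P(3) closed[OF P(3) eV, of p "- l p s"] unfolding l'_def by (cases "p = s") auto
    moreover have "l' p q = (if p = q then 1 else 0)" if "p \<in> insert s P" "q \<in> insert s P" for p q
      using that e P(4) sP unfolding l'_def by auto
    ultimately show ?thesis
      using rep P(1,2) f0(2) by (intro exI[of _ "insert s P"] exI[of _ l'] conjI ballI) blast+
  qed
qed

definition monomial :: "nat list \<Rightarrow> 'k :: field vec \<Rightarrow> 'k" where
  "monomial xs v = (\<Prod>i\<leftarrow>xs. v $ i)"

lemma degree_less_finite_span:
  assumes "degree_less n d p"
  shows "\<exists>c. \<forall>v. p v = (\<Sum>xs\<in>{xs. set xs \<subseteq> {..<n} \<and> length xs \<le> d}. c xs * monomial xs v)"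
  using assms
proof induction
  case (zero d)
  show ?case by (rule exI[of _ "\<lambda>_. 0"]) simp
next
  case (const d a)
  let ?L = "{xs. set xs \<subseteq> {..<n} \<and> length xs \<le> Suc d}"
  have "(\<Sum>xs\<in>?L. (if xs = [] then a else 0) * monomial xs v) = (\<Sum>xs\<in>?L. (if xs = [] then a else 0))"
    for v by (intro sum.cong) (auto simp: monomial_def)
  then show ?case
    by (intro exI[of _ "\<lambda>xs. if xs = [] then a else 0"]) (simp add: finite_lists_length_le sum.delta)
next
  case (coord i d p)
  let ?L = "{xs. set xs \<subseteq> {..<n} \<and> length xs \<le> d}"
  let ?M = "{xs. set xs \<subseteq> {..<n} \<and> length xs \<le> Suc d}"
  obtain c where c: "\<And>v. p v = (\<Sum>xs\<in>?L. c xs * monomial xs v)" using coord by blast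
  let ?c = "\<lambda>xs. if xs \<in> (#) i ` ?L then c (tl xs) else 0"
  have "v $ i * p v = (\<Sum>xs\<in>?M. ?c xs * monomial xs v)" for v
  proof -
    have "(\<Sum>xs\<in>?M. ?c xs * monomial xs v) = (\<Sum>xs\<in>(#) i ` ?L. ?c xs * monomial xs v)"
      by (rule sum.mono_neutral_right) (use coord(1) in \<open>auto simp: finite_lists_length_le\<close>)
    also have "\<dots> = (\<Sum>xs\<in>?L. c xs * monomial (i # xs) v)"
      by (subst sum.reindex) auto
    also have "\<dots> = v $ i * p v"
      unfolding c monomial_def sum_distrib_left by (simp add: ac_simps)
    finally show ?thesis by simp
  qed
  then show ?case by (intro exI[of _ ?c]) blast
next
  case (add d p q)
  then obtain b c where
    "\<And>v. p v = (\<Sum>xs\<in>{xs. set xs \<subseteq> {..<n} \<and> length xs \<le> d}. b xs * monomial xs v)"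
    "\<And>v. q v = (\<Sum>xs\<in>{xs. set xs \<subseteq> {..<n} \<and> length xs \<le> d}. c xs * monomial xs v)" by blast
  then show ?case
    by (intro exI[of _ "\<lambda>xs. b xs + c xs"]) (simp add: distrib_right sum.distrib)
qed

lemma degree_less_interpolation:
  fixes n d :: nat
  obtains P :: "'k :: field vec set" and l where "finite P" "P \<subseteq> carrier_vec n" "\<And>x. x \<in> P \<Longrightarrow> degree_less n d (l x)"
    "\<And>x y. x \<in> P \<Longrightarrow> y \<in> P \<Longrightarrow> l x y = (if x = y then 1 else 0)"
    "\<And>f v. degree_less n d f \<Longrightarrow> v \<in> carrier_vec n \<Longrightarrow> f v = (\<Sum>x\<in>P. f x * l x v)"
proof -
  let ?V = "Collect (degree_less n d) :: ('k vec \<Rightarrow> 'k) set"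
  have "\<exists>P l. finite P \<and> P \<subseteq> carrier_vec n \<and> (\<forall>p\<in>P. l p \<in> ?V) \<and>
     (\<forall>p\<in>P. \<forall>q\<in>P. l p q = (if p = q then 1 else 0)) \<and>
     (\<forall>f\<in>?V. \<forall>v\<in>carrier_vec n. f v = (\<Sum>p\<in>P. f p * l p v))"
  proof (rule interpolation[where I = "{xs. set xs \<subseteq> {..<n} \<and> length xs \<le> d}" and b = monomial])
    show "\<exists>c. \<forall>v\<in>carrier_vec n. f v = (\<Sum>xs\<in>{xs. set xs \<subseteq> {..<n} \<and> length xs \<le> d}. c xs * monomial xs v)"
      if "f \<in> ?V" for f using degree_less_finite_span[of n d f] that by blast
  qed (auto intro: finite_lists_length_le degree_less.add degree_less_scale)
  then obtain P l where Pl: "finite P \<and> P \<subseteq> carrier_vec n \<and> (\<forall>p\<in>P. l p \<in> ?V) \<and>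
     (\<forall>p\<in>P. \<forall>q\<in>P. l p q = (if p = q then 1 else 0)) \<and>
     (\<forall>f\<in>?V. \<forall>v\<in>carrier_vec n. f v = (\<Sum>p\<in>P. f p * l p v))" by (elim exE)
  show thesis by (rule that[of P l]) (use Pl in blast)+
qed

section \<open>Translation invariant algebras of polynomial functions\<close>

text \<open>The identity holds for \<open>c\<close> a natural number, and both sides are polynomial in \<open>c\<close>.\<close>

lemma polyfun_additive_homogeneous:
  fixes k :: "'k :: field_char_0 vec \<Rightarrow> 'k"
  assumes k: "polyfun n k" and add: "\<And>x y. x \<in> carrier_vec n \<Longrightarrow> y \<in> carrier_vec n \<Longrightarrow> k (x + y) = k x + k y"
    and x: "x \<in> carrier_vec n"
  shows "k (c \<cdot>\<^sub>v x) = c * k x"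
proof -
  obtain P where "\<forall>c. k (0\<^sub>v n + c \<cdot>\<^sub>v x) = poly P c" using polyfun_line[OF k zero_carrier_vec x] by blast
  then have P: "k (c \<cdot>\<^sub>v x) = poly P c" for c using x by simp
  have nat: "k (of_nat m \<cdot>\<^sub>v x) = of_nat m * k x" for m
  proof (induction m)
    case 0
    have "k (0\<^sub>v n + 0\<^sub>v n) = k (0\<^sub>v n) + k (0\<^sub>v n)" by (rule add) auto
    moreover have "0 \<cdot>\<^sub>v x = 0\<^sub>v n" using x by auto
    ultimately show ?case by simp
  next
    case (Suc m)
    have "of_nat (Suc m) \<cdot>\<^sub>v x = x + of_nat m \<cdot>\<^sub>v x" using x by (auto simp: algebra_simps)
    then show ?case using Suc add[OF x, of "of_nat m \<cdot>\<^sub>v x"] x by (simp add: algebra_simps)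
  qed
  have "P - [:0, k x:] = 0"
  proof (rule ccontr)
    assume "P - [:0, k x:] \<noteq> 0"
    then have "finite {c. poly (P - [:0, k x:]) c = 0}" by (rule poly_roots_finite)
    moreover have "range of_nat \<subseteq> {c. poly (P - [:0, k x:]) c = 0}"
      using nat by (auto simp: P)
    ultimately have "finite (range (of_nat :: nat \<Rightarrow> 'k))" by (rule rev_finite_subset)
    then show False by (simp add: finite_image_iff inj_of_nat)
  qed
  then have "poly (P - [:0, k x:]) c = 0" by simp
  then show ?thesis by (simp add: P)
qed

lemma polyfun_additive_linear:
  fixes k :: "'k :: field_char_0 vec \<Rightarrow> 'k"
  assumes k: "polyfun n k" and add: "\<And>x y. x \<in> carrier_vec n \<Longrightarrow> y \<in> carrier_vec n \<Longrightarrow> k (x + y) = k x + k y"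
    and x: "x \<in> carrier_vec n"
  shows "k x = (\<Sum>i<n. k (unit_vec n i) * x $ i)"
proof -
  have "k (vec n (\<lambda>i. if i < m then x $ i else 0)) = (\<Sum>i<m. k (unit_vec n i) * x $ i)" if "m \<le> n" for m
    using that
  proof (induction m)
    case 0
    have "vec n (\<lambda>i. 0) = (0 :: 'k) \<cdot>\<^sub>v x" using x by auto
    then show ?case using polyfun_additive_homogeneous[OF k add x, of 0] by simp
  next
    case (Suc m)
    have "vec n (\<lambda>i. if i < Suc m then x $ i else 0)
        = vec n (\<lambda>i. if i < m then x $ i else 0) + x $ m \<cdot>\<^sub>v unit_vec n m"
      using Suc.prems by (intro eq_vecI) (auto simp: less_Suc_eq)
    also have "k \<dots> = k (vec n (\<lambda>i. if i < m then x $ i else 0)) + k (x $ m \<cdot>\<^sub>v unit_vec n m)"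
      by (rule add) auto
    also have "k (x $ m \<cdot>\<^sub>v unit_vec n m) = x $ m * k (unit_vec n m)"
      by (rule polyfun_additive_homogeneous[OF k add]) auto
    finally show ?case using Suc by simp
  qed
  from this[of n] have "k (vec n (\<lambda>i. if i < n then x $ i else 0)) = (\<Sum>i<n. k (unit_vec n i) * x $ i)" by simp
  moreover have "vec n (\<lambda>i. if i < n then x $ i else 0) = x" using x by (intro eq_vecI) auto
  ultimately show ?thesis by simp
qed

text \<open>Let \<open>L\<close> be the space of linear forms in \<open>R\<close> and \<open>N\<close> the subspace on which they vanish. Interpolation
  for \<open>L\<close> provides a linear map \<open>T\<close> with \<open>f \<circ> T = f\<close> for \<open>f\<close> in \<open>L\<close> whose coordinates are in \<open>L\<close>; it is
  a projection with kernel \<open>N\<close>, and \<open>h \<circ> T\<close> lies in \<open>R\<close> for every polynomial \<open>h\<close>. The vectors in \<open>N\<close>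
  are periods of every \<open>h\<close> in \<open>R\<close>, by induction on the degree: the differences of \<open>h\<close> have lower
  degree, so the increment of \<open>h\<close> along a vector of \<open>N\<close> does not depend on the starting point, and
  \<open>h - h \<circ> T\<close> is an additive polynomial, hence a linear form in \<open>L\<close>, which vanishes on \<open>N\<close>. If there
  are no common periods, then \<open>N = 0\<close> and \<open>T\<close> is the identity.\<close>

lemma translation_invariant_algebra_coordinates:
  fixes R :: "('k :: field_char_0 vec \<Rightarrow> 'k) set"
  assumes poly: "\<And>h. h \<in> R \<Longrightarrow> polyfun n h"
    and const: "\<And>c. (\<lambda>_. c) \<in> R"
    and add: "\<And>f h. f \<in> R \<Longrightarrow> h \<in> R \<Longrightarrow> (\<lambda>v. f v + h v) \<in> R"
    and mult: "\<And>f h. f \<in> R \<Longrightarrow> h \<in> R \<Longrightarrow> (\<lambda>v. f v * h v) \<in> R"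
    and translate: "\<And>h g. h \<in> R \<Longrightarrow> g \<in> carrier_vec n \<Longrightarrow> (\<lambda>v. h (v + g)) \<in> R"
    and periods: "\<And>v. v \<in> carrier_vec n \<Longrightarrow> (\<And>h t. h \<in> R \<Longrightarrow> t \<in> carrier_vec n \<Longrightarrow> h (t + v) = h t) \<Longrightarrow> v = 0\<^sub>v n"
    and i: "i < n"
  shows "\<exists>h\<in>R. \<forall>v\<in>carrier_vec n. h v = v $ i"
proof -
  define L where "L = {h \<in> R. \<exists>c. \<forall>v\<in>carrier_vec n. h v = (\<Sum>i<n. c i * v $ i)}"
  have LR: "L \<subseteq> R" unfolding L_def by blast
  have scale: "(\<lambda>v. c * h v) \<in> R" if "h \<in> R" for c h
    using mult[OF const that] .
  have diff: "(\<lambda>v. f v - h v) \<in> R" if "f \<in> R" "h \<in> R" for f h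
    using add[OF that(1) scale[OF that(2), of "-1"]] by simp
  have sum: "(\<lambda>v. \<Sum>p\<in>P. f p v) \<in> R" if "\<And>p. p \<in> P \<Longrightarrow> f p \<in> R" for P f
    using that by (induction P rule: infinite_finite_induct) (auto intro: const add)
  have L_add: "l (x + y) = l x + l y" if l: "l \<in> L" and x: "x \<in> carrier_vec n" and y: "y \<in> carrier_vec n" for l x y
  proof -
    obtain c where c: "\<And>v. v \<in> carrier_vec n \<Longrightarrow> l v = (\<Sum>i<n. c i * v $ i)"
      using l unfolding L_def by blast
    have "l (x + y) = (\<Sum>i<n. c i * (x + y) $ i)" by (rule c) (use x y in auto)
    also have "\<dots> = (\<Sum>i<n. c i * x $ i + c i * y $ i)"
      using y by (intro sum.cong) (auto simp: algebra_simps)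
    finally show ?thesis using c[OF x] c[OF y] by (simp add: sum.distrib)
  qed
  have "\<exists>P l. finite P \<and> P \<subseteq> carrier_vec n \<and> (\<forall>p\<in>P. l p \<in> L) \<and>
          (\<forall>p\<in>P. \<forall>q\<in>P. l p q = (if p = q then 1 else 0)) \<and>
          (\<forall>f\<in>L. \<forall>x\<in>carrier_vec n. f x = (\<Sum>p\<in>P. f p * l p x))"
  proof (rule interpolation[where I = "{..<n}" and b = "\<lambda>i v. v $ i"])
    fix f h a assume fh: "f \<in> L" "h \<in> L"
    then obtain c d where cd: "\<And>v. v \<in> carrier_vec n \<Longrightarrow> f v = (\<Sum>i<n. c i * v $ i)"
      "\<And>v. v \<in> carrier_vec n \<Longrightarrow> h v = (\<Sum>i<n. d i * v $ i)" unfolding L_def by blast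
    have "f v + a * h v = (\<Sum>i<n. (c i + a * d i) * v $ i)" if "v \<in> carrier_vec n" for v
      using cd[OF that] by (simp add: distrib_right sum.distrib sum_distrib_left mult.assoc)
    moreover have "(\<lambda>v. f v + a * h v) \<in> R" using fh LR by (intro add scale) auto
    ultimately show "(\<lambda>v. f v + a * h v) \<in> L"
      unfolding L_def by (intro CollectI conjI exI[of _ "\<lambda>i. c i + a * d i"] ballI)
  next
    fix f assume "f \<in> L"
    then show "\<exists>c. \<forall>x\<in>carrier_vec n. f x = (\<Sum>i\<in>{..<n}. c i * x $ i)" unfolding L_def by blast
  qed simp
  then obtain P l where Pl: "finite P \<and> P \<subseteq> carrier_vec n \<and> (\<forall>p\<in>P. l p \<in> L) \<and>
          (\<forall>p\<in>P. \<forall>q\<in>P. l p q = (if p = q then 1 else 0)) \<and>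
          (\<forall>f\<in>L. \<forall>x\<in>carrier_vec n. f x = (\<Sum>p\<in>P. f p * l p x))" by (elim exE)
  then have P: "finite P" "P \<subseteq> carrier_vec n" and lL: "\<And>p. p \<in> P \<Longrightarrow> l p \<in> L" by auto
  have rep: "f x = (\<Sum>p\<in>P. f p * l p x)" if "f \<in> L" "x \<in> carrier_vec n" for f x
    using Pl that by blast
  have lR: "l p \<in> R" if "p \<in> P" for p using lL[OF that] LR by blast
  define T where "T x = vec n (\<lambda>i. \<Sum>p\<in>P. l p x * p $ i)" for x
  have T: "T x \<in> carrier_vec n" for x unfolding T_def by simp
  have T_add: "T (x + y) = T x + T y" if "x \<in> carrier_vec n" "y \<in> carrier_vec n" for x y
    unfolding T_def
    by (intro eq_vecI) (auto simp: distrib_right sum.distrib L_add[OF lL that])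
  have L_T: "f (T x) = f x" if f: "f \<in> L" and x: "x \<in> carrier_vec n" for f x
  proof -
    obtain c where c: "\<And>v. v \<in> carrier_vec n \<Longrightarrow> f v = (\<Sum>i<n. c i * v $ i)"
      using f unfolding L_def by blast
    have "f (T x) = (\<Sum>i<n. \<Sum>p\<in>P. l p x * (c i * p $ i))"
      unfolding c[OF T] by (rule sum.cong) (auto simp: T_def sum_distrib_left ac_simps)
    also have "\<dots> = (\<Sum>p\<in>P. l p x * f p)"
      by (subst sum.swap) (use P(2) c in \<open>auto simp: sum_distrib_left intro!: sum.cong\<close>)
    also have "\<dots> = f x" unfolding rep[OF f x] by (simp add: ac_simps)
    finally show ?thesis .
  qed
  define N where "N = {v \<in> carrier_vec n. \<forall>f\<in>L. f v = 0}"
  have N_carrier: "v \<in> carrier_vec n" if "v \<in> N" for v using that unfolding N_def by blast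
  have L_0: "f (0\<^sub>v n) = 0" if "f \<in> L" for f
    using L_add[OF that, of "0\<^sub>v n" "0\<^sub>v n"] by simp
  have T_N: "T v = 0\<^sub>v n" if "v \<in> N" for v
    unfolding T_def using that lL unfolding N_def by (intro eq_vecI) (auto intro!: sum.neutral)
  have N_compl: "x - T x \<in> N" if x: "x \<in> carrier_vec n" for x
  proof -
    have "f (x - T x) = 0" if f: "f \<in> L" for f
    proof -
      have "f ((x - T x) + T x) = f (x - T x) + f (T x)" by (rule L_add[OF f]) (use x T in auto)
      moreover have "(x - T x) + T x = x" using x T by (intro eq_vecI) (auto simp: carrier_vecD[OF T])
      ultimately show ?thesis using L_T[OF f x] by simp
    qed
    then show ?thesis using x T unfolding N_def by auto
  qed
  have RT: "(\<lambda>x. h (T x)) \<in> R" if "polyfun n h" for h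
    using that
  proof induction
    case (coord j)
    have "(\<lambda>x. \<Sum>p\<in>P. p $ j * l p x) \<in> R" by (intro sum scale lR)
    then show ?case using coord by (simp add: T_def ac_simps)
  qed (auto intro: const add mult)
  have period: "h (t + v) = h t" if "degree_less n d h" "h \<in> R" "v \<in> N" "t \<in> carrier_vec n" for d h v t
    using that
  proof (induction d arbitrary: h v t)
    case 0
    then show ?case using degree_less_0 by metis
  next
    case (Suc d)
    note h = Suc.prems(1,2)
    have shift: "h (g + v) - h g = h v - h (0\<^sub>v n)" if v: "v \<in> N" and g: "g \<in> carrier_vec n" for v g
    proof -
      have "(\<lambda>x. h (x + g) - h x) (0\<^sub>v n + v) = (\<lambda>x. h (x + g) - h x) (0\<^sub>v n)"
        using degree_less_difference[OF h(1) g] diff[OF translate[OF h(2) g] h(2)] v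
        by (intro Suc.IH) auto
      then show ?thesis using N_carrier[OF v] g by (simp add: comm_add_vec[of g n v] algebra_simps)
    qed
    \<comment> \<open>the increments of \<open>h\<close> along \<open>N\<close>, extended to a linear form by the projection\<close>
    define k where "k x = h x - h (T x)" for x
    have k: "k x = h (x - T x) - h (0\<^sub>v n)" if x: "x \<in> carrier_vec n" for x
    proof -
      have "T x + (x - T x) = x" using x T by (intro eq_vecI) (auto simp: carrier_vecD[OF T])
      then show ?thesis using shift[OF N_compl[OF x] T[of x]] by (simp add: k_def)
    qed
    have kR: "k \<in> R" unfolding k_def using diff[OF h(2) RT[OF poly[OF h(2)]]] by simp
    have k_add: "k (x + y) = k x + k y" if x: "x \<in> carrier_vec n" and y: "y \<in> carrier_vec n" for x y
    proof -
      have "(x + y) - T (x + y) = (x - T x) + (y - T y)"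
        unfolding T_add[OF x y] using x y
        by (intro eq_vecI) (auto simp: carrier_vecD[OF T])
      moreover have "h ((x - T x) + (y - T y)) = h (x - T x) + h (y - T y) - h (0\<^sub>v n)"
        using shift[OF N_compl[OF y] N_carrier[OF N_compl[OF x]]] by (simp add: algebra_simps)
      ultimately show ?thesis using k x y by simp
    qed
    have "k \<in> L"
      unfolding L_def using kR polyfun_additive_linear[OF poly[OF kR] k_add]
      by (intro CollectI conjI exI[of _ "\<lambda>i. k (unit_vec n i)"]) auto
    then have "k v = 0" using Suc.prems(3) unfolding N_def by blast
    then have "h v = h (0\<^sub>v n)" unfolding k_def T_N[OF Suc.prems(3)] by simp
    then show ?case using shift[OF Suc.prems(3,4)] by simp
  qed
  have "x = T x" if x: "x \<in> carrier_vec n" for x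
  proof -
    have "x - T x = 0\<^sub>v n"
    proof (rule periods)
      show "x - T x \<in> carrier_vec n" using x T by simp
      fix h and t :: "'k vec" assume h: "h \<in> R" and t: "t \<in> carrier_vec n"
      obtain d where "degree_less n d h" using polyfun_degree_less[OF poly[OF h]] by blast
      from period[OF this h N_compl[OF x] t] show "h (t + (x - T x)) = h t" .
    qed
    then have "(x - T x) $ j = 0" if "j < n" for j using that by simp
    then show ?thesis using x T by (intro eq_vecI) (auto simp: carrier_vecD[OF T])
  qed
  then show ?thesis using RT[OF polyfun.coord[OF i]] by (intro bexI[of _ "\<lambda>x. T x $ i"]) auto
qed

section \<open>Spaces with functions\<close>

context space_with_functions
begin

lemma reg_cong:
  assumes "openin (space_top X) U" "f \<in> reg X U" "\<And>x. x \<in> U \<Longrightarrow> f x = g x"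
  shows "g \<in> reg X U"
  using assms by (intro reg_local[OF assms(1)] exI[of _ U] exI[of _ f]) auto

lemma reg_sum:
  assumes "openin (space_top X) U" "\<And>i. i \<in> I \<Longrightarrow> f i \<in> reg X U"
  shows "(\<lambda>x. \<Sum>i\<in>I. f i x) \<in> reg X U"
  using assms(2) by (induction I rule: infinite_finite_induct) (simp_all add: reg_const reg_add assms(1))

lemma reg_diff:
  assumes "openin (space_top X) U" "f \<in> reg X U" "g \<in> reg X U"
  shows "(\<lambda>x. f x - g x) \<in> reg X U"
  using reg_add[OF assms(1,2) reg_mult[OF assms(1) reg_const[OF assms(1), of "-1"] assms(3)]] by simp

lemma reg_divide:
  assumes "openin (space_top X) U" "f \<in> reg X U" "g \<in> reg X U"
  shows "(\<lambda>x. f x / g x) \<in> reg X {x \<in> U. g x \<noteq> 0}"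
proof -
  have o: "openin (space_top X) {x \<in> U. g x \<noteq> 0}" by (rule open_nonzero[OF assms(1,3)])
  have "f \<in> reg X {x \<in> U. g x \<noteq> 0}" by (rule reg_restrict[OF assms(1) o _ assms(2)]) blast
  from reg_mult[OF o this reg_inverse[OF assms(1,3)]] show ?thesis by (simp add: divide_inverse)
qed

lemma reg_polyfun:
  assumes "polyfun n p" "openin (space_top X) U" "\<And>i. i < n \<Longrightarrow> (\<lambda>x. f x $ i) \<in> reg X U"
  shows "(\<lambda>x. p (f x)) \<in> reg X U"
  using assms(1) by induction (simp_all add: assms(2,3) reg_const reg_add reg_mult)

text \<open>Gaussian elimination: the last hypothesis, at the single point \<open>x0\<close>, provides a pivot that does not
  vanish at \<open>x0\<close>; it is invertible on a neighbourhood, where the eliminated system is again regular.\<close>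

lemma linear_system_regular:
  assumes "finite J" "openin (space_top X) U" "x0 \<in> U"
    and "\<And>e j. e \<in> E \<Longrightarrow> j \<in> J \<Longrightarrow> a e j \<in> reg X U" "\<And>e. e \<in> E \<Longrightarrow> b e \<in> reg X U"
    and "\<And>e x. e \<in> E \<Longrightarrow> x \<in> U \<Longrightarrow> (\<Sum>j\<in>J. a e j x * y j x) = b e x"
    and "\<And>c j. (\<And>e. e \<in> E \<Longrightarrow> (\<Sum>j\<in>J. a e j x0 * c j) = 0) \<Longrightarrow> j \<in> J \<Longrightarrow> c j = 0"
  shows "\<exists>V. openin (space_top X) V \<and> x0 \<in> V \<and> V \<subseteq> U \<and> (\<forall>j\<in>J. y j \<in> reg X V)"
  using assms
proof (induction J arbitrary: U a b rule: finite_induct)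
  case empty
  then show ?case by blast
next
  case (insert k J)
  note U = insert.prems(1) and reg_a = insert.prems(3) and reg_b = insert.prems(4)
    and eq = insert.prems(5) and ker = insert.prems(6)
  obtain e0 where e0: "e0 \<in> E" "a e0 k x0 \<noteq> 0"
  proof (rule ccontr)
    assume "\<not> thesis"
    then have z: "a e k x0 = 0" if "e \<in> E" for e using that \<open>\<And>e0. e0 \<in> E \<Longrightarrow> a e0 k x0 \<noteq> 0 \<Longrightarrow> thesis\<close> by blast
    have "(\<Sum>j\<in>insert k J. a e j x0 * (if j = k then 1 else 0)) = 0" if "e \<in> E" for e
      using z[OF that] by (intro sum.neutral) auto
    from ker[OF this, of k] show False by simp
  qed
  let ?W = "{x \<in> U. a e0 k x \<noteq> 0}"
  have W: "openin (space_top X) ?W" using open_nonzero[OF U reg_a] e0 by simp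
  have restr: "f \<in> reg X ?W" if "f \<in> reg X U" for f
    by (rule reg_restrict[OF U W _ that]) blast
  have quot: "(\<lambda>x. f x / a e0 k x) \<in> reg X ?W" if "f \<in> reg X U" for f
    using reg_divide[OF U that reg_a] e0 by simp
  \<comment> \<open>the system obtained by eliminating the unknown \<open>k\<close> with the equation \<open>e0\<close>\<close>
  let ?a = "\<lambda>e j x. a e j x - a e k x * (a e0 j x / a e0 k x)"
  let ?b = "\<lambda>e x. b e x - a e k x * (b e0 x / a e0 k x)"
  have solve: "y k x = b e0 x / a e0 k x - (\<Sum>j\<in>J. (a e0 j x / a e0 k x) * y j x)" if "x \<in> ?W" for x
  proof -
    have "a e0 k x * y k x = b e0 x - (\<Sum>j\<in>J. a e0 j x * y j x)"
      using eq[OF e0(1), of x] that insert.hyps by (simp add: algebra_simps)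
    then have "y k x = (b e0 x - (\<Sum>j\<in>J. a e0 j x * y j x)) / a e0 k x"
      using that by (simp add: field_simps)
    then show ?thesis by (simp add: diff_divide_distrib sum_divide_distrib)
  qed
  have "\<exists>V. openin (space_top X) V \<and> x0 \<in> V \<and> V \<subseteq> ?W \<and> (\<forall>j\<in>J. y j \<in> reg X V)"
  proof (rule insert.IH[of ?W ?a ?b])
    show "openin (space_top X) ?W" by (rule W)
    show "x0 \<in> ?W" using insert.prems(2) e0 by simp
    show "?a e j \<in> reg X ?W" if "e \<in> E" "j \<in> J" for e j
      by (intro reg_diff reg_mult W restr quot reg_a) (use that e0 in auto)
    show "?b e \<in> reg X ?W" if "e \<in> E" for e
      by (intro reg_diff reg_mult W restr quot reg_a reg_b) (use that e0 in auto)
    show "(\<Sum>j\<in>J. ?a e j x * y j x) = ?b e x" if "e \<in> E" "x \<in> ?W" for e x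
    proof -
      have "(\<Sum>j\<in>J. ?a e j x * y j x)
          = (\<Sum>j\<in>J. a e j x * y j x) - a e k x * (\<Sum>j\<in>J. (a e0 j x / a e0 k x) * y j x)"
        by (simp add: sum_distrib_left sum_subtractf[symmetric] algebra_simps)
      also have "\<dots> = ?b e x"
        using eq[OF that(1), of x] that(2) insert.hyps
        unfolding sum.insert[OF insert.hyps] solve[OF that(2)] by (simp add: algebra_simps)
      finally show ?thesis .
    qed
    show "c j = 0" if c: "\<And>e. e \<in> E \<Longrightarrow> (\<Sum>j\<in>J. ?a e j x0 * c j) = 0" and j: "j \<in> J" for c j
    proof -
      let ?c = "c(k := - (\<Sum>j\<in>J. (a e0 j x0 / a e0 k x0) * c j))"
      have "(\<Sum>j\<in>insert k J. a e j x0 * ?c j) = 0" if "e \<in> E" for e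
      proof -
        have "(\<Sum>j\<in>insert k J. a e j x0 * ?c j)
            = (\<Sum>j\<in>J. a e j x0 * c j) - a e k x0 * (\<Sum>j\<in>J. (a e0 j x0 / a e0 k x0) * c j)"
          unfolding sum.insert[OF insert.hyps] using insert.hyps(2) by (auto intro!: sum.cong)
        also have "\<dots> = (\<Sum>j\<in>J. ?a e j x0 * c j)"
          by (simp add: sum_distrib_left sum_subtractf[symmetric] algebra_simps)
        finally show ?thesis using c[OF that] by simp
      qed
      from ker[OF this, of j] have "?c j = 0" using j by simp
      then show ?thesis using j insert.hyps(2) by (auto split: if_splits)
    qed
  qed
  then obtain V where V: "openin (space_top X) V" "x0 \<in> V" "V \<subseteq> ?W" "\<And>j. j \<in> J \<Longrightarrow> y j \<in> reg X V" by blast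
  have restr': "f \<in> reg X V" if "f \<in> reg X ?W" for f
    by (rule reg_restrict[OF W V(1,3) that])
  have "(\<lambda>x. b e0 x / a e0 k x - (\<Sum>j\<in>J. (a e0 j x / a e0 k x) * y j x)) \<in> reg X V"
    by (intro reg_diff reg_sum reg_mult V restr' quot reg_a reg_b) (use e0 in auto)
  then have "y k \<in> reg X V" by (rule reg_cong[OF V(1)]) (rule solve[symmetric], rule subsetD[OF V(3)])
  then show ?case using V by (intro exI[of _ V] conjI) auto
qed

end

section \<open>Morphisms\<close>

lemma morphism_in_points: "morphism X Y f \<Longrightarrow> x \<in> points X \<Longrightarrow> f x \<in> points Y"
  unfolding morphism_def points_def continuous_map_def by auto

lemma morphism_preimage:
  "morphism X Y f \<Longrightarrow> openin (space_top Y) V \<Longrightarrow> openin (space_top X) {x \<in> points X. f x \<in> V}"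
  unfolding morphism_def points_def continuous_map_def by auto

lemma morphism_pullback:
  "morphism X Y f \<Longrightarrow> openin (space_top Y) V \<Longrightarrow> h \<in> reg Y V \<Longrightarrow>
     (\<lambda>x. h (f x)) \<in> reg X {x \<in> points X. f x \<in> V}"
  unfolding morphism_def by auto

lemma morphismI:
  assumes "\<And>x. x \<in> points X \<Longrightarrow> f x \<in> points Y"
    and "\<And>V. openin (space_top Y) V \<Longrightarrow> openin (space_top X) {x \<in> points X. f x \<in> V}"
    and "\<And>V h. openin (space_top Y) V \<Longrightarrow> h \<in> reg Y V \<Longrightarrow> (\<lambda>x. h (f x)) \<in> reg X {x \<in> points X. f x \<in> V}"
  shows "morphism X Y f"
  using assms unfolding morphism_def points_def continuous_map_def by auto

lemma morphism_compose:
  assumes f: "morphism X Y f" and g: "morphism Y Z g"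
  shows "morphism X Z (\<lambda>x. g (f x))"
proof (rule morphismI)
  fix V assume V: "openin (space_top Z) V"
  have eq: "{x \<in> points X. g (f x) \<in> V} = {x \<in> points X. f x \<in> {y \<in> points Y. g y \<in> V}}"
    using morphism_in_points[OF f] by auto
  show "openin (space_top X) {x \<in> points X. g (f x) \<in> V}"
    unfolding eq by (intro morphism_preimage[OF f] morphism_preimage[OF g] V)
  show "(\<lambda>x. h (g (f x))) \<in> reg X {x \<in> points X. g (f x) \<in> V}" if "h \<in> reg Z V" for h
    unfolding eq by (intro morphism_pullback[OF f] morphism_preimage[OF g] morphism_pullback[OF g] V that)
qed (use f g in \<open>auto dest: morphism_in_points\<close>)

lemma morphism_ident: "morphism X X (\<lambda>x. x)"
proof (rule morphismI)
  fix V assume "openin (space_top X) V"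
  then have "{x \<in> points X. x \<in> V} = V" using openin_subset unfolding points_def by auto
  then show "openin (space_top X) {x \<in> points X. x \<in> V}"
    "\<And>h. h \<in> reg X V \<Longrightarrow> (\<lambda>x. h x) \<in> reg X {x \<in> points X. x \<in> V}"
    using \<open>openin (space_top X) V\<close> by simp_all
qed

lemma reg_product_spaceD:
  assumes "F \<in> reg (product_space Y Z) W" "z \<in> W"
  shows "\<exists>U V h k. openin (space_top Y) U \<and> openin (space_top Z) V \<and>
        h \<in> tensor_functions Y Z U V \<and> k \<in> tensor_functions Y Z U V \<and>
        z \<in> {w \<in> U \<times> V. k w \<noteq> 0} \<and> {w \<in> U \<times> V. k w \<noteq> 0} \<subseteq> W \<and>
        (\<forall>w\<in>{w \<in> U \<times> V. k w \<noteq> 0}. F w = h w / k w)"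
  using assms(1) unfolding product_space_def function_space.simps mem_Collect_eq
  by (rule bspec) (rule assms(2))

lemma openin_points: "openin (space_top X) (points X)"
  by (simp add: points_def)

context space_with_functions
begin

lemma morphism_const: "c \<in> points Y \<Longrightarrow> morphism X Y (\<lambda>_. c)"
proof (rule morphismI)
  fix V
  show o: "openin (space_top X) {x \<in> points X. c \<in> V}"
    using openin_points[of X] by (cases "c \<in> V") auto
  show "(\<lambda>x. h c) \<in> reg X {x \<in> points X. c \<in> V}" for h by (rule reg_const[OF o])
qed

lemma tensor_pullback:
  assumes f: "morphism X Y f" and g: "morphism X Z g"
    and U: "openin (space_top Y) U" and V: "openin (space_top Z) V"
    and h: "h \<in> tensor_functions Y Z U V"
  shows "openin (space_top X) {x \<in> points X. f x \<in> U \<and> g x \<in> V}"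
    and "(\<lambda>x. h (f x, g x)) \<in> reg X {x \<in> points X. f x \<in> U \<and> g x \<in> V}"
proof -
  let ?A = "{x \<in> points X. f x \<in> U}" and ?B = "{x \<in> points X. g x \<in> V}"
  let ?C = "{x \<in> points X. f x \<in> U \<and> g x \<in> V}"
  have A: "openin (space_top X) ?A" and B: "openin (space_top X) ?B"
    by (rule morphism_preimage[OF f U] morphism_preimage[OF g V])+
  have "?C = ?A \<inter> ?B" by blast
  then show C: "openin (space_top X) ?C" using A B by (simp add: openin_Int)
  obtain r a b where ab: "\<forall>i<r. a i \<in> reg Y U \<and> b i \<in> reg Z V"
    and heq: "h = (\<lambda>(x, y). \<Sum>i<(r::nat). a i x * b i y)"
    using h unfolding tensor_functions_def by blast
  have "(\<lambda>x. a i (f x)) \<in> reg X ?C" if "i < r" for i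
    by (rule reg_restrict[OF A C _ morphism_pullback[OF f U]]) (use ab that in auto)
  moreover have "(\<lambda>x. b i (g x)) \<in> reg X ?C" if "i < r" for i
    by (rule reg_restrict[OF B C _ morphism_pullback[OF g V]]) (use ab that in auto)
  ultimately show "(\<lambda>x. h (f x, g x)) \<in> reg X ?C"
    unfolding heq by (auto intro!: reg_sum reg_mult C)
qed

text \<open>The universal property of the product; it is what all uses of \<open>product_space\<close> reduce to, except
  for the local description of regular functions.\<close>

lemma morphism_pair:
  assumes f: "morphism X Y f" and g: "morphism X Z g"
    and one: "(\<lambda>_. 1) \<in> reg Y (points Y)" "(\<lambda>_. 1) \<in> reg Z (points Z)"
  shows "morphism X (product_space Y Z) (\<lambda>x. (f x, g x))"
proof -
  let ?basis = "{{z \<in> U \<times> V. h z \<noteq> 0} | U V h. openin (space_top Y) U \<and> openin (space_top Z) V \<and>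
                                      h \<in> tensor_functions Y Z U V}"
  have basic: "openin (space_top X) {x \<in> points X. (f x, g x) \<in> {z \<in> U \<times> V. k z \<noteq> 0}}"
    and quotient: "h \<in> tensor_functions Y Z U V \<Longrightarrow>
      (\<lambda>x. h (f x, g x) / k (f x, g x)) \<in> reg X {x \<in> points X. (f x, g x) \<in> {z \<in> U \<times> V. k z \<noteq> 0}}"
    if "openin (space_top Y) U" "openin (space_top Z) V" "k \<in> tensor_functions Y Z U V" for U V h k
  proof -
    have eq: "{x \<in> points X. (f x, g x) \<in> {z \<in> U \<times> V. k z \<noteq> 0}}
        = {x \<in> {x \<in> points X. f x \<in> U \<and> g x \<in> V}. k (f x, g x) \<noteq> 0}" by auto
    note t = tensor_pullback[OF f g that(1,2)]
    show "openin (space_top X) {x \<in> points X. (f x, g x) \<in> {z \<in> U \<times> V. k z \<noteq> 0}}"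
      unfolding eq by (rule open_nonzero[OF t[OF that(3)]])
    show "(\<lambda>x. h (f x, g x) / k (f x, g x)) \<in> reg X {x \<in> points X. (f x, g x) \<in> {z \<in> U \<times> V. k z \<noteq> 0}}"
      if "h \<in> tensor_functions Y Z U V"
      unfolding eq by (rule reg_divide[OF t(1)[OF that] t(2)[OF that] t(2)[OF \<open>k \<in> _\<close>]])
  qed
  have const1: "(\<lambda>_. 1) \<in> tensor_functions Y Z (points Y) (points Z)"
    unfolding tensor_functions_def
    by (intro CollectI exI[of _ 1] exI[of _ "\<lambda>_ _. 1"]) (use one in auto)
  have "continuous_map (space_top X) (topology_generated_by ?basis) (\<lambda>x. (f x, g x))"
  proof (rule continuous_on_generated_topo)
    fix W assume "W \<in> ?basis"
    then obtain U V k where W: "W = {z \<in> U \<times> V. k z \<noteq> 0}" "openin (space_top Y) U" "openin (space_top Z) V"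
      "k \<in> tensor_functions Y Z U V" by blast
    have "(\<lambda>x. (f x, g x)) -` W \<inter> topspace (space_top X) = {x \<in> points X. (f x, g x) \<in> W}"
      unfolding points_def by auto
    then show "openin (space_top X) ((\<lambda>x. (f x, g x)) -` W \<inter> topspace (space_top X))"
      using basic[OF W(2-4)] unfolding W(1) by simp
  next
    have "{z \<in> points Y \<times> points Z. (\<lambda>_. 1 :: 'k) z \<noteq> 0} \<in> ?basis"
      by (intro CollectI exI[of _ "points Y"] exI[of _ "points Z"] exI[of _ "\<lambda>_. 1"] conjI openin_points const1) simp
    moreover have "(\<lambda>x. (f x, g x)) ` topspace (space_top X) \<subseteq> {z \<in> points Y \<times> points Z. (\<lambda>_. 1 :: 'k) z \<noteq> 0}"
      using morphism_in_points[OF f] morphism_in_points[OF g] unfolding points_def by auto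
    ultimately show "(\<lambda>x. (f x, g x)) ` topspace (space_top X) \<subseteq> \<Union>?basis" by blast
  qed
  then have cont: "continuous_map (space_top X) (space_top (product_space Y Z)) (\<lambda>x. (f x, g x))"
    unfolding product_space_def by simp
  have "(\<lambda>x. F (f x, g x)) \<in> reg X {x \<in> points X. (f x, g x) \<in> W}"
    if W: "openin (space_top (product_space Y Z)) W" and F: "F \<in> reg (product_space Y Z) W" for W F
  proof (rule reg_local)
    show o: "openin (space_top X) {x \<in> points X. (f x, g x) \<in> W}"
      using cont W unfolding continuous_map_def points_def by auto
    fix x assume x: "x \<in> {x \<in> points X. (f x, g x) \<in> W}"
    then have z: "(f x, g x) \<in> W" by simp
    from reg_product_spaceD[OF F z]
    obtain U V h k where
      UV: "openin (space_top Y) U" "openin (space_top Z) V"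
      and hk: "h \<in> tensor_functions Y Z U V" "k \<in> tensor_functions Y Z U V"
      and z: "(f x, g x) \<in> {w \<in> U \<times> V. k w \<noteq> 0}" "{w \<in> U \<times> V. k w \<noteq> 0} \<subseteq> W"
      and eq: "\<And>w. w \<in> {w \<in> U \<times> V. k w \<noteq> 0} \<Longrightarrow> F w = h w / k w"
      by (elim exE conjE) blast
    show "\<exists>N G. openin (space_top X) N \<and> x \<in> N \<and> N \<subseteq> {x \<in> points X. (f x, g x) \<in> W} \<and> G \<in> reg X N \<and>
            (\<forall>y\<in>N. F (f y, g y) = G y)"
      using x z by (intro exI[of _ "{x \<in> points X. (f x, g x) \<in> {z \<in> U \<times> V. k z \<noteq> 0}}"]
          exI[of _ "\<lambda>x. h (f x, g x) / k (f x, g x)"] conjI basic quotient UV hk ballI eq) auto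
  qed
  with cont show ?thesis unfolding morphism_def by blast
qed

end

subsection \<open>Open subspaces\<close>

lemma openin_open_subspace:
  assumes "openin (space_top X) U"
  shows "openin (space_top (open_subspace X U)) V \<longleftrightarrow> openin (space_top X) V \<and> V \<subseteq> U"
  using openin_open_subtopology[OF assms] by (simp add: open_subspace_def)

lemma points_open_subspace:
  assumes "openin (space_top X) U"
  shows "points (open_subspace X U) = U"
  using openin_subset[OF assms] unfolding points_def open_subspace_def by auto

lemma reg_open_subspace [simp]: "reg (open_subspace X U) = reg X"
  by (simp add: open_subspace_def)

lemma (in space_with_functions) space_with_functions_open_subspace:
  assumes U: "openin (space_top X) U"
  shows "space_with_functions (open_subspace X U)"
proof (unfold_locales, unfold openin_open_subspace[OF U] reg_open_subspace)
  fix W f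
  assume W: "openin (space_top X) W \<and> W \<subseteq> U"
    and loc: "\<And>x. x \<in> W \<Longrightarrow> \<exists>V g. (openin (space_top X) V \<and> V \<subseteq> U) \<and> x \<in> V \<and> V \<subseteq> W \<and> g \<in> reg X V \<and> (\<forall>y\<in>V. f y = g y)"
  show "f \<in> reg X W"
  proof (rule reg_local)
    fix x assume "x \<in> W"
    from loc[OF this] show "\<exists>V g. openin (space_top X) V \<and> x \<in> V \<and> V \<subseteq> W \<and> g \<in> reg X V \<and> (\<forall>y\<in>V. f y = g y)"
      by (elim exE conjE) (intro exI conjI)
  qed (use W in blast)
next
  fix W V f
  assume "openin (space_top X) W \<and> W \<subseteq> U" "openin (space_top X) V \<and> V \<subseteq> U" "V \<subseteq> W" "f \<in> reg X W"
  then show "f \<in> reg X V" using reg_restrict[of W V f] by blast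
qed (auto intro: reg_const reg_add reg_mult open_nonzero reg_inverse)

lemma morphism_into_open_subspace:
  assumes U: "openin (space_top X) U" and f: "morphism Y X f" and "\<And>y. y \<in> points Y \<Longrightarrow> f y \<in> U"
  shows "morphism Y (open_subspace X U) f"
  by (rule morphismI, unfold openin_open_subspace[OF U] reg_open_subspace points_open_subspace[OF U])
    (auto intro: assms(3) morphism_preimage[OF f] morphism_pullback[OF f])

section \<open>Affine space\<close>

lemma space_top_affine_space: "space_top (affine_space n) = zariski n"
  unfolding affine_space_def affine_structure_def
  using subtopology_topspace[of "zariski n"] by (simp add: topspace_zariski)

lemma points_affine_space: "points (affine_space n) = carrier_vec n"
  unfolding points_def space_top_affine_space by (rule topspace_zariski)

lemma reg_affine_space_iff:
  fixes f :: "'k :: field vec \<Rightarrow> 'k"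
  shows "f \<in> reg (affine_space n) U \<longleftrightarrow>
     (\<forall>x\<in>U. \<exists>V p q. openin (zariski n) V \<and> x \<in> V \<and> V \<subseteq> U \<and>
        polyfun n p \<and> polyfun n q \<and> (\<forall>y\<in>V. q y \<noteq> 0 \<and> f y = p y / q y))"
  using subtopology_topspace[of "zariski n :: 'k vec topology"]
  by (simp add: affine_space_def affine_structure_def topspace_zariski)

lemma const_reg_affine_space: "(\<lambda>_. c) \<in> reg (affine_space n) (points (affine_space n))"
  unfolding reg_affine_space_iff points_affine_space
proof
  fix x :: "'a vec" assume "x \<in> carrier_vec n"
  moreover have "openin (zariski n) (carrier_vec n :: 'a vec set)"
    using openin_topspace[of "zariski n :: 'a vec topology"] unfolding topspace_zariski .
  ultimately show "\<exists>V p q. openin (zariski n) V \<and> x \<in> V \<and> V \<subseteq> carrier_vec n \<and>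
        polyfun n p \<and> polyfun n q \<and> (\<forall>y\<in>V. q y \<noteq> 0 \<and> c = p y / q y)"
    by (intro exI[of _ "carrier_vec n"] exI[of _ "\<lambda>_. c"] exI[of _ "\<lambda>_. 1"]) (auto intro: polyfun.const)
qed

lemma zariski_principal_open:
  assumes "openin (zariski n) S" "s \<in> S"
  shows "\<exists>r. polyfun n r \<and> r s \<noteq> 0 \<and> (\<forall>v\<in>carrier_vec n. r v \<noteq> 0 \<longrightarrow> v \<in> S)"
proof -
  obtain T where T: "T \<subseteq> Collect (polyfun n)" "carrier_vec n - S = zero_locus n T" and S: "S \<subseteq> carrier_vec n"
    using assms(1) unfolding openin_zariski algebraic_set_def by blast
  have "s \<notin> zero_locus n T" using assms(2) T(2) by blast
  then obtain r where "r \<in> T" "r s \<noteq> 0" using assms(2) S unfolding zero_locus_def by blast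
  moreover have "v \<in> S" if "v \<in> carrier_vec n" "r v \<noteq> 0" for v
    using that \<open>r \<in> T\<close> T(2) unfolding zero_locus_def by blast
  ultimately show ?thesis using T(1) by blast
qed

lemma affine_space_common_denominator:
  fixes a :: "'i \<Rightarrow> 'k :: field vec \<Rightarrow> 'k"
  assumes "finite I" "openin (zariski n) S" "s \<in> S" "\<And>i. i \<in> I \<Longrightarrow> a i \<in> reg (affine_space n) S"
  shows "\<exists>r p. polyfun n r \<and> r s \<noteq> 0 \<and> (\<forall>i\<in>I. polyfun n (p i)) \<and>
           (\<forall>v\<in>carrier_vec n. r v \<noteq> 0 \<longrightarrow> v \<in> S \<and> (\<forall>i\<in>I. p i v = r v * a i v))"
  using assms(1,4)
proof (induction I rule: finite_induct)
  case empty
  then show ?case using zariski_principal_open[OF assms(2,3)] by auto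
next
  case (insert i I)
  then obtain r p where r: "polyfun n r" "r s \<noteq> 0" and p: "\<forall>i\<in>I. polyfun n (p i)"
    and rp: "\<forall>v\<in>carrier_vec n. r v \<noteq> 0 \<longrightarrow> v \<in> S \<and> (\<forall>i\<in>I. p i v = r v * a i v)" by auto
  obtain V f g where V: "openin (zariski n) V" "s \<in> V" and fg: "polyfun n f" "polyfun n g"
    and V': "\<And>y. y \<in> V \<Longrightarrow> g y \<noteq> 0 \<and> a i y = f y / g y"
    using insert.prems[of i] assms(3) unfolding reg_affine_space_iff by blast
  obtain t where t: "polyfun n t" "t s \<noteq> 0" "\<And>v. v \<in> carrier_vec n \<Longrightarrow> t v \<noteq> 0 \<Longrightarrow> v \<in> V"
    using zariski_principal_open[OF V] by blast
  let ?r = "\<lambda>v. r v * (t v * g v)"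
  let ?p = "\<lambda>j v. if j = i then f v * (r v * t v) else p j v * (t v * g v)"
  have "polyfun n ?r" using r t fg by (intro polyfun.mult)
  moreover have "?r s \<noteq> 0" using r t V' V by simp
  moreover have "polyfun n (?p j)" if "j \<in> insert i I" for j
    using r t fg p that insert.hyps by (cases "j = i") (auto intro!: polyfun.mult)
  moreover have "v \<in> S \<and> (\<forall>j\<in>insert i I. ?p j v = ?r v * a j v)" if "v \<in> carrier_vec n" "?r v \<noteq> 0" for v
  proof -
    have "r v \<noteq> 0" "v \<in> V" "g v \<noteq> 0" using that t by auto
    then show ?thesis using rp that(1) V' by auto
  qed
  ultimately show ?case by (intro exI[of _ ?r] exI[of _ ?p]) blast
qed

lemma (in space_with_functions) morphism_affine_spaceI:
  assumes f: "\<And>x. x \<in> points X \<Longrightarrow> f x \<in> carrier_vec n"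
    and coords: "\<And>i. i < n \<Longrightarrow> (\<lambda>x. f x $ i) \<in> reg X (points X)"
  shows "morphism X (affine_space n) f"
proof (rule morphismI, unfold space_top_affine_space points_affine_space)
  have poly: "(\<lambda>x. p (f x)) \<in> reg X (points X)" if "polyfun n p" for p
    using reg_polyfun[OF that openin_points coords] .
  show pre: "openin (space_top X) {x \<in> points X. f x \<in> S}" if S: "openin (zariski n) S" for S
  proof -
    obtain T where T: "T \<subseteq> Collect (polyfun n)" "carrier_vec n - S = zero_locus n T" and "S \<subseteq> carrier_vec n"
      using S unfolding openin_zariski algebraic_set_def by blast
    have "f x \<in> S \<longleftrightarrow> (\<exists>p\<in>T. p (f x) \<noteq> 0)" if "x \<in> points X" for x
    proof -
      have "f x \<in> S \<longleftrightarrow> f x \<notin> zero_locus n T" using T(2) f[OF that] by blast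
      then show ?thesis using f[OF that] by (simp add: zero_locus_def)
    qed
    then have "{x \<in> points X. f x \<in> S} = (\<Union>p\<in>T. {x \<in> points X. p (f x) \<noteq> 0})" by blast
    moreover have "openin (space_top X) (\<Union>p\<in>T. {x \<in> points X. p (f x) \<noteq> 0})"
      using T(1) open_nonzero[OF openin_points poly] by blast
    ultimately show ?thesis by simp
  qed
  show "(\<lambda>x. h (f x)) \<in> reg X {x \<in> points X. f x \<in> S}"
    if S: "openin (zariski n) S" and h: "h \<in> reg (affine_space n) S" for S h
  proof (rule reg_local[OF pre[OF S]])
    fix x assume x: "x \<in> {x \<in> points X. f x \<in> S}"
    then have "\<exists>V p q. openin (zariski n) V \<and> f x \<in> V \<and> V \<subseteq> S \<and> polyfun n p \<and> polyfun n q \<and>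
        (\<forall>y\<in>V. q y \<noteq> 0 \<and> h y = p y / q y)"
      using h[unfolded reg_affine_space_iff, THEN bspec] by simp
    then obtain V p q where V: "openin (zariski n) V" "f x \<in> V" "V \<subseteq> S" and pq: "polyfun n p" "polyfun n q"
      and eq: "\<And>y. y \<in> V \<Longrightarrow> q y \<noteq> 0 \<and> h y = p y / q y" by (elim exE conjE) simp
    let ?N = "{x \<in> points X. f x \<in> V}"
    have N: "openin (space_top X) ?N" by (rule pre[OF V(1)])
    have r: "(\<lambda>x. t (f x)) \<in> reg X ?N" if "polyfun n t" for t
      by (rule reg_restrict[OF openin_points N _ poly[OF that]]) blast
    have "{x \<in> ?N. q (f x) \<noteq> 0} = ?N" using eq by blast
    then have "(\<lambda>x. p (f x) / q (f x)) \<in> reg X ?N" using reg_divide[OF N r[OF pq(1)] r[OF pq(2)]] by simp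
    then show "\<exists>V g. openin (space_top X) V \<and> x \<in> V \<and> V \<subseteq> {x \<in> points X. f x \<in> S} \<and> g \<in> reg X V \<and>
        (\<forall>y\<in>V. h (f y) = g y)"
      using N x V eq by (intro exI[of _ ?N] exI[of _ "\<lambda>x. p (f x) / q (f x)"] conjI ballI) auto
  qed
qed (rule f)

text \<open>A tensor involves finitely many regular functions on affine space, which have a common denominator
  \<open>r\<close> near \<open>s0\<close>.\<close>

lemma tensor_functions_affine_space:
  assumes "space_with_functions X"
    and h: "h \<in> tensor_functions (affine_space n) X S V"
    and S: "openin (zariski n) S" "s0 \<in> S" and V: "openin (space_top X) V"
  obtains r A where "polyfun n r" "r s0 \<noteq> 0" "\<And>u. polyfun n (\<lambda>s. A s u)" "\<And>s. A s \<in> reg X V"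
    "\<And>s u. s \<in> carrier_vec n \<Longrightarrow> r s \<noteq> 0 \<Longrightarrow> s \<in> S \<and> A s u = r s * h (s, u)"
proof -
  interpret space_with_functions X by fact
  obtain m a b where ab: "\<And>i. i < m \<Longrightarrow> a i \<in> reg (affine_space n) S" "\<And>i. i < m \<Longrightarrow> b i \<in> reg X V"
    and heq: "h = (\<lambda>(x, y). \<Sum>i<(m::nat). a i x * b i y)"
    using h unfolding tensor_functions_def by blast
  have "\<exists>r p. polyfun n r \<and> r s0 \<noteq> 0 \<and> (\<forall>i\<in>{..<m}. polyfun n (p i)) \<and>
      (\<forall>v\<in>carrier_vec n. r v \<noteq> 0 \<longrightarrow> v \<in> S \<and> (\<forall>i\<in>{..<m}. p i v = r v * a i v))"
    by (rule affine_space_common_denominator[OF finite_lessThan S]) (simp add: ab(1))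
  then obtain r p where
    "polyfun n r \<and> r s0 \<noteq> 0 \<and> (\<forall>i\<in>{..<m}. polyfun n (p i)) \<and>
      (\<forall>v\<in>carrier_vec n. r v \<noteq> 0 \<longrightarrow> v \<in> S \<and> (\<forall>i\<in>{..<m}. p i v = r v * a i v))" by (elim exE)
  then have r: "polyfun n r" "r s0 \<noteq> 0" and p: "\<And>i. i < m \<Longrightarrow> polyfun n (p i)"
    and rp: "\<And>v. v \<in> carrier_vec n \<Longrightarrow> r v \<noteq> 0 \<Longrightarrow> v \<in> S \<and> (\<forall>i<m. p i v = r v * a i v)"
    by auto
  let ?A = "\<lambda>s u. \<Sum>i<m. p i s * b i u"
  have "polyfun n (\<lambda>s. ?A s u)" for u
    by (intro polyfun_sum polyfun.mult p polyfun.const) auto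
  moreover have "?A s \<in> reg X V" for s
    by (intro reg_sum reg_mult reg_const V ab(2)) auto
  moreover have "?A s u = r s * h (s, u)" if "s \<in> carrier_vec n" "r s \<noteq> 0" for s u
    using rp[OF that] by (simp add: heq sum_distrib_left mult.assoc)
  ultimately show thesis using rp by (intro that[of r ?A] r conjI) auto
qed

section \<open>The orbit map\<close>

locale additive_orbit = space_with_functions X
  for X :: "('p, 'k :: field_char_0) function_space" +
  fixes n :: nat and \<alpha> :: "'k vec \<Rightarrow> 'p \<Rightarrow> 'p" and x0 :: 'p and U :: "'p set"
  assumes variety: "irreducible_variety X"
    and action: "additive_action n X \<alpha>"
    and x0: "x0 \<in> points X"
    and orbit: "U = {\<alpha> g x0 | g. g \<in> carrier_vec n}"
    and U: "openin (space_top X) U"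
begin

lemma faithful: "faithful_action (Ga TYPE('k) n) (points X) \<alpha>"
  using action unfolding additive_action_def by blast

lemma action_add: "g \<in> carrier_vec n \<Longrightarrow> h \<in> carrier_vec n \<Longrightarrow> x \<in> points X \<Longrightarrow> \<alpha> (g + h) x = \<alpha> g (\<alpha> h x)"
  and action_zero: "x \<in> points X \<Longrightarrow> \<alpha> (0\<^sub>v n) x = x"
  and action_inj: "g \<in> carrier_vec n \<Longrightarrow> h \<in> carrier_vec n \<Longrightarrow> \<alpha> g = \<alpha> h \<Longrightarrow> g = h"
  and action_extensional: "g \<in> carrier_vec n \<Longrightarrow> \<alpha> g \<in> extensional (points X)"
proof -
  interpret faithful_action "Ga TYPE('k) n" "points X" \<alpha> by (rule faithful)
  show "g \<in> carrier_vec n \<Longrightarrow> h \<in> carrier_vec n \<Longrightarrow> x \<in> points X \<Longrightarrow> \<alpha> (g + h) x = \<alpha> g (\<alpha> h x)"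
    using composition_rule[of x g h] by (simp add: monoid_vec_simps)
  show "x \<in> points X \<Longrightarrow> \<alpha> (0\<^sub>v n) x = x"
    using id_eq_one by (metis monoid_vec_simps(3) restrict_apply')
  show "g \<in> carrier_vec n \<Longrightarrow> h \<in> carrier_vec n \<Longrightarrow> \<alpha> g = \<alpha> h \<Longrightarrow> g = h"
    using faithful by (auto simp: monoid_vec_simps dest: inj_onD)
  show "g \<in> carrier_vec n \<Longrightarrow> \<alpha> g \<in> extensional (points X)"
    using bij_prop0[of g] by (auto simp: monoid_vec_simps Bij_def)
qed

lemma one_reg: "(\<lambda>_. 1) \<in> reg X (points X)"
  by (rule reg_const[OF openin_points])

lemma action_morphism:
  assumes "space_with_functions Y" "morphism Y (affine_space n) t" "morphism Y X f"
  shows "morphism Y X (\<lambda>y. \<alpha> (t y) (f y))"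
proof -
  interpret Y: space_with_functions Y by fact
  have "morphism (product_space (affine_space n) X) X (\<lambda>(g, x). \<alpha> g x)"
    using action unfolding additive_action_def by blast
  from morphism_compose[OF Y.morphism_pair[OF assms(2,3) const_reg_affine_space one_reg] this]
  show ?thesis by simp
qed

lemma translation_morphism: "g \<in> carrier_vec n \<Longrightarrow> morphism X X (\<alpha> g)"
  using action_morphism[OF space_with_functions_axioms morphism_const morphism_ident, of g]
  by (simp add: points_affine_space)

lemma U_sub: "U \<subseteq> points X"
  using openin_subset[OF U] by (simp add: points_def)

lemma x0_U: "x0 \<in> U"
  unfolding orbit using action_zero[OF x0] zero_carrier_vec[of n] by (intro CollectI exI[of _ "0\<^sub>v n"]) simp

text \<open>A group element that fixes \<open>x0\<close> fixes the dense orbit pointwise, as the group is commutative,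
  and hence all of \<open>X\<close>, as \<open>X\<close> is separated.\<close>

lemma stabilizer_trivial:
  assumes v: "v \<in> carrier_vec n" and fixes_x0: "\<alpha> v x0 = x0"
  shows "v = 0\<^sub>v n"
proof -
  let ?D = "{(x, x) | x. x \<in> points X}"
  let ?C = "{x \<in> topspace (space_top X). (\<alpha> v x, x) \<in> ?D}"
  have "morphism X (product_space X X) (\<lambda>x. (\<alpha> v x, x))"
    by (rule morphism_pair[OF translation_morphism[OF v] morphism_ident one_reg one_reg])
  then have "continuous_map (space_top X) (space_top (product_space X X)) (\<lambda>x. (\<alpha> v x, x))"
    unfolding morphism_def by blast
  moreover have "closedin (space_top (product_space X X)) ?D"
    using variety unfolding irreducible_variety_def variety_def by blast
  ultimately have C: "closedin (space_top X) ?C" by (rule closedin_continuous_map_preimage)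
  have "\<alpha> v x = x" if "x \<in> U" for x
  proof -
    obtain g where g: "g \<in> carrier_vec n" "x = \<alpha> g x0" using \<open>x \<in> U\<close> unfolding orbit by blast
    have "\<alpha> v x = \<alpha> (g + v) x0"
      unfolding g(2) action_add[OF v g(1) x0, symmetric] using v g(1) by (simp add: comm_add_vec[of g n v])
    then show ?thesis using action_add[OF g(1) v x0] fixes_x0 g(2) by simp
  qed
  then have "?C \<union> (topspace (space_top X) - U) = topspace (space_top X)"
    using U_sub unfolding points_def by auto
  moreover have "closedin (space_top X) (topspace (space_top X) - U)" using U by blast
  ultimately have "?C = topspace (space_top X) \<or> topspace (space_top X) - U = topspace (space_top X)"
    using variety C unfolding irreducible_variety_def irreducible_space_def by blast
  moreover have "topspace (space_top X) - U \<noteq> topspace (space_top X)"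
    using x0_U U_sub unfolding points_def by blast
  ultimately have "?C = topspace (space_top X)" by blast
  then have all: "\<alpha> v x = x" if "x \<in> points X" for x
  proof -
    have "x \<in> ?C" unfolding \<open>?C = topspace (space_top X)\<close> using that by (simp add: points_def)
    then show ?thesis by simp
  qed
  have "\<alpha> v = \<alpha> (0\<^sub>v n)"
  proof (rule extensionalityI[of _ "points X"])
    fix x assume "x \<in> points X"
    then show "\<alpha> v x = \<alpha> (0\<^sub>v n) x" using all action_zero by simp
  qed (use v in \<open>auto intro: action_extensional\<close>)
  then show ?thesis using action_inj[OF v zero_carrier_vec] by blast
qed

text \<open>The inverse of the orbit map.\<close>

definition \<tau> :: "'p \<Rightarrow> 'k vec" where
  "\<tau> u = (THE g. g \<in> carrier_vec n \<and> \<alpha> g x0 = u)"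

lemma orbit_map_inj:
  assumes g: "g \<in> carrier_vec n" and h: "h \<in> carrier_vec n" and eq: "\<alpha> g x0 = \<alpha> h x0"
  shows "g = h"
proof -
  have "\<alpha> (- h + g) x0 = \<alpha> (- h + h) x0"
    using g h eq x0 by (simp add: action_add del: uminus_l_inv_vec)
  then have "\<alpha> (- h + g) x0 = x0" using h by (simp add: action_zero x0)
  then have "- h + g = 0\<^sub>v n" using g h by (intro stabilizer_trivial) auto
  then have "(- h + g) $ i = 0" if "i < n" for i using that by simp
  then show ?thesis using g h by (intro eq_vecI) auto
qed

lemma \<tau>_orbit_map: "g \<in> carrier_vec n \<Longrightarrow> \<tau> (\<alpha> g x0) = g"
  unfolding \<tau>_def by (rule the_equality) (simp, blast intro: orbit_map_inj)

lemma \<tau>_carrier: "u \<in> U \<Longrightarrow> \<tau> u \<in> carrier_vec n"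
  and orbit_map_\<tau>: "u \<in> U \<Longrightarrow> \<alpha> (\<tau> u) x0 = u"
proof -
  assume "u \<in> U"
  then obtain g where "g \<in> carrier_vec n" "u = \<alpha> g x0" unfolding orbit by blast
  then show "\<tau> u \<in> carrier_vec n" "\<alpha> (\<tau> u) x0 = u" by (simp_all add: \<tau>_orbit_map)
qed

lemma action_U:
  assumes "g \<in> carrier_vec n" "u \<in> U"
  shows "\<alpha> g u \<in> U"
proof -
  have "\<alpha> g u = \<alpha> (g + \<tau> u) x0"
    using assms by (simp add: action_add \<tau>_carrier x0 orbit_map_\<tau>)
  moreover have "g + \<tau> u \<in> carrier_vec n" using assms \<tau>_carrier by simp
  ultimately show ?thesis unfolding orbit by blast
qed

lemma \<tau>_action:
  assumes "g \<in> carrier_vec n" "u \<in> U"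
  shows "\<tau> (\<alpha> g u) = g + \<tau> u"
proof -
  have "\<alpha> g u = \<alpha> (g + \<tau> u) x0"
    using assms by (simp add: action_add \<tau>_carrier x0 orbit_map_\<tau>)
  then show ?thesis using assms \<tau>_carrier by (simp add: \<tau>_orbit_map)
qed

text \<open>The action is a morphism on the product, where regular functions are locally quotients of tensors.
  Clearing denominators makes numerator and denominator polynomial in the group element; the
  polynomial \<open>r\<close> marks where the cleared denominators do not vanish.\<close>

lemma action_local_quotient:
  assumes C: "openin (space_top X) C" "x0 \<in> C" and F: "F \<in> reg X C"
  obtains V r A B where "openin (space_top X) V" "x0 \<in> V" "V \<subseteq> U"
    "polyfun n r" "r (0\<^sub>v n) \<noteq> 0"
    "\<And>u. polyfun n (\<lambda>s. A s u)" "\<And>u. polyfun n (\<lambda>s. B s u)"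
    "\<And>s. A s \<in> reg X V" "\<And>s. B s \<in> reg X V" "\<And>u. u \<in> V \<Longrightarrow> B (0\<^sub>v n) u \<noteq> 0"
    "\<And>s u. u \<in> V \<Longrightarrow> s \<in> carrier_vec n \<Longrightarrow> r s \<noteq> 0 \<Longrightarrow> B s u \<noteq> 0 \<Longrightarrow>
       \<alpha> s u \<in> C \<and> F (\<alpha> s u) * B s u = A s u"
proof -
  let ?X2 = "product_space (affine_space n) X"
  let ?W = "{z \<in> points ?X2. (case z of (g, x) \<Rightarrow> \<alpha> g x) \<in> C}"
  have act: "morphism ?X2 X (\<lambda>(g, x). \<alpha> g x)"
    using action unfolding additive_action_def by blast
  have pair: "morphism X ?X2 (\<lambda>x. (0\<^sub>v n, x))"
    by (rule morphism_pair[OF morphism_const morphism_ident const_reg_affine_space one_reg])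
      (simp add: points_affine_space)
  have z0: "(0\<^sub>v n, x0) \<in> ?W"
    using morphism_in_points[OF pair x0] C(2) by (simp add: action_zero x0)
  have "(\<lambda>z. F (case z of (g, x) \<Rightarrow> \<alpha> g x)) \<in> reg ?X2 ?W"
    by (rule morphism_pullback[OF act C(1) F])
  from reg_product_spaceD[OF this z0, unfolded space_top_affine_space]
  obtain S V h k where S: "openin (zariski n) S" and V: "openin (space_top X) V"
    and h: "h \<in> tensor_functions (affine_space n) X S V" and k: "k \<in> tensor_functions (affine_space n) X S V"
    and z: "0\<^sub>v n \<in> S" "x0 \<in> V" "k (0\<^sub>v n, x0) \<noteq> 0"
    and WC: "{w \<in> S \<times> V. k w \<noteq> 0} \<subseteq> ?W"
    and eq: "\<forall>w\<in>{w \<in> S \<times> V. k w \<noteq> 0}. F (case w of (g, x) \<Rightarrow> \<alpha> g x) = h w / k w"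
    by (elim exE conjE) simp
  obtain r1 A where r1: "polyfun n r1" "r1 (0\<^sub>v n) \<noteq> 0" "\<And>u. polyfun n (\<lambda>s. A s u)" "\<And>s. A s \<in> reg X V"
    "\<And>s u. s \<in> carrier_vec n \<Longrightarrow> r1 s \<noteq> 0 \<Longrightarrow> s \<in> S \<and> A s u = r1 s * h (s, u)"
    by (rule tensor_functions_affine_space[OF space_with_functions_axioms h S z(1) V], rule that)
  obtain r2 B where r2: "polyfun n r2" "r2 (0\<^sub>v n) \<noteq> 0" "\<And>u. polyfun n (\<lambda>s. B s u)" "\<And>s. B s \<in> reg X V"
    "\<And>s u. s \<in> carrier_vec n \<Longrightarrow> r2 s \<noteq> 0 \<Longrightarrow> s \<in> S \<and> B s u = r2 s * k (s, u)"
    by (rule tensor_functions_affine_space[OF space_with_functions_axioms k S z(1) V], rule that)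
  let ?A = "\<lambda>s u. r2 s * A s u" and ?B = "\<lambda>s u. r1 s * B s u"
  have regV: "?A s \<in> reg X V" "?B s \<in> reg X V" for s
    by (intro reg_mult reg_const r1 r2 V)+
  let ?V = "{u \<in> V. ?B (0\<^sub>v n) u \<noteq> 0} \<inter> U"
  have V': "openin (space_top X) ?V" by (intro openin_Int open_nonzero[OF V regV(2)] U)
  have quot: "\<alpha> s u \<in> C \<and> F (\<alpha> s u) * ?B s u = ?A s u"
    if u: "u \<in> ?V" and s: "s \<in> carrier_vec n" and r: "r1 s * r2 s \<noteq> 0" "?B s u \<noteq> 0" for s u
  proof -
    have "k (s, u) \<noteq> 0" "s \<in> S" using r r2(5)[OF s, of u] by auto
    then have "(s, u) \<in> {w \<in> S \<times> V. k w \<noteq> 0}" using u by simp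
    then have "\<alpha> s u \<in> C" "F (\<alpha> s u) = h (s, u) / k (s, u)" using WC bspec[OF eq] by auto
    then show ?thesis using r r1(5)[OF s, of u] r2(5)[OF s, of u] by simp
  qed
  have "x0 \<in> ?V" using z r1 r2 x0_U by simp
  have restr: "f \<in> reg X ?V" if "f \<in> reg X V" for f
    by (rule reg_restrict[OF V V' _ that]) blast
  show thesis
  proof (rule that[of ?V "\<lambda>s. r1 s * r2 s" ?A ?B])
    show "openin (space_top X) ?V" "x0 \<in> ?V" "?V \<subseteq> U" by (rule V', fact, blast)
    show "polyfun n (\<lambda>s. r1 s * r2 s)" "polyfun n (\<lambda>s. ?A s u)" "polyfun n (\<lambda>s. ?B s u)" for u
      by (intro polyfun.mult r1 r2)+
    show "r1 (0\<^sub>v n) * r2 (0\<^sub>v n) \<noteq> 0" using r1 r2 by simp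
    show "?A s \<in> reg X ?V" "?B s \<in> reg X ?V" for s by (intro restr regV)+
    show "?B (0\<^sub>v n) u \<noteq> 0" if "u \<in> ?V" for u using that by blast
    show "\<alpha> s u \<in> C \<and> F (\<alpha> s u) * ?B s u = ?A s u"
      if "u \<in> ?V" "s \<in> carrier_vec n" "r1 s * r2 s \<noteq> 0" "?B s u \<noteq> 0" for s u by (rule quot[OF that])
  qed
qed

definition orbit_algebra :: "('k vec \<Rightarrow> 'k) set" where
  "orbit_algebra = {h. polyfun n h \<and> (\<lambda>u. h (\<tau> u)) \<in> reg X U}"

text \<open>Regularity near \<open>x0\<close> suffices, if it holds for all translates of \<open>h\<close>: the action carries \<open>x0\<close> to
  every point of the orbit, and it corresponds to the translations of \<open>K\<^sup>n\<close>.\<close>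

lemma orbit_algebraI:
  assumes h: "polyfun n h" and V: "openin (space_top X) V" "x0 \<in> V" "V \<subseteq> U"
    and near: "\<And>s. s \<in> carrier_vec n \<Longrightarrow> (\<lambda>u. h (s + \<tau> u)) \<in> reg X V"
  shows "h \<in> orbit_algebra"
  unfolding orbit_algebra_def
proof (intro CollectI conjI h reg_local U)
  fix u1 assume u1: "u1 \<in> U"
  let ?g = "\<tau> u1"
  have g: "?g \<in> carrier_vec n" "- ?g \<in> carrier_vec n" using \<tau>_carrier[OF u1] by auto
  let ?N = "{u \<in> points X. \<alpha> (- ?g) u \<in> V}"
  have undo: "\<alpha> ?g (\<alpha> (- ?g) u) = u" if "u \<in> points X" for u
  proof -
    have "?g + - ?g = 0\<^sub>v n" using g by (intro eq_vecI) auto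
    then show ?thesis using action_add[OF g that] action_zero[OF that] by simp
  qed
  have NU: "?N \<subseteq> U" using undo action_U[OF g(1)] V(3) by fastforce
  have "h (\<tau> u) = h (?g + \<tau> (\<alpha> (- ?g) u))" if "u \<in> ?N" for u
    using \<tau>_action[OF g(1), of "\<alpha> (- ?g) u"] undo that V(3) by auto
  moreover have "\<alpha> (- ?g) u1 = x0"
    using action_add[OF g(2,1) x0] orbit_map_\<tau>[OF u1] g(1) by (simp add: action_zero x0)
  then have "u1 \<in> ?N" using u1 U_sub V(2) by auto
  moreover have "openin (space_top X) ?N" by (rule morphism_preimage[OF translation_morphism[OF g(2)] V(1)])
  moreover have "(\<lambda>u. h (?g + \<tau> (\<alpha> (- ?g) u))) \<in> reg X ?N"
    by (rule morphism_pullback[OF translation_morphism[OF g(2)] V(1) near[OF g(1)]])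
  ultimately show "\<exists>V f. openin (space_top X) V \<and> u1 \<in> V \<and> V \<subseteq> U \<and> f \<in> reg X V \<and> (\<forall>y\<in>V. h (\<tau> y) = f y)"
    using NU by (intro exI[of _ ?N] exI[of _ "\<lambda>u. h (?g + \<tau> (\<alpha> (- ?g) u))"] conjI ballI) auto
qed

text \<open>The fraction with a denominator \<open>q\<close> of least degree has the required properties. The unknowns of the linear
  system are the values of \<open>p (s + \<tau> u)\<close> and \<open>q (s + \<tau> u) - q s\<close> at interpolation points for the
  polynomials in \<open>s\<close> of the degrees in question; there is one equation for each \<open>s\<close>. A nontrivial
  solution of the homogeneous system at \<open>x0\<close> would be a fraction with a denominator of smaller
  degree than \<open>q\<close>, as \<open>q (s + \<tau> u) - q s\<close> has smaller degree than \<open>q\<close>.\<close>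

lemma coordinate_fraction:
  assumes C: "openin (space_top X) C" "x0 \<in> C" and F: "F \<in> reg X C"
  obtains p q w where "p \<in> orbit_algebra" "q \<in> orbit_algebra" "polyfun n w" "\<exists>s\<in>carrier_vec n. w s \<noteq> 0"
    "\<And>s. s \<in> carrier_vec n \<Longrightarrow> w s \<noteq> 0 \<Longrightarrow> \<alpha> s x0 \<in> C \<and> q s \<noteq> 0 \<and> F (\<alpha> s x0) = p s / q s"
proof -
  obtain V r A B where V: "openin (space_top X) V" "x0 \<in> V" "V \<subseteq> U"
    and r: "polyfun n r" "r (0\<^sub>v n) \<noteq> 0"
    and polyA: "\<And>u. polyfun n (\<lambda>s. A s u)" and polyB: "\<And>u. polyfun n (\<lambda>s. B s u)"
    and regA: "\<And>s. A s \<in> reg X V" and regB: "\<And>s. B s \<in> reg X V"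
    and B0: "\<And>u. u \<in> V \<Longrightarrow> B (0\<^sub>v n) u \<noteq> 0"
    and quot: "\<And>s u. u \<in> V \<Longrightarrow> s \<in> carrier_vec n \<Longrightarrow> r s \<noteq> 0 \<Longrightarrow> B s u \<noteq> 0 \<Longrightarrow>
       \<alpha> s u \<in> C \<and> F (\<alpha> s u) * B s u = A s u"
    by (rule action_local_quotient[OF C F], rule that)
  define fraction where "fraction p q \<longleftrightarrow> polyfun n p \<and> (\<exists>s\<in>carrier_vec n. q s \<noteq> 0) \<and>
      (\<forall>s\<in>carrier_vec n. p s * B s x0 = q s * A s x0)" for p q
  define d where "d = (LEAST d. \<exists>p q. fraction p q \<and> degree_less n d q)"
  obtain d0 where "degree_less n d0 (\<lambda>s. B s x0)" using polyfun_degree_less[OF polyB] by blast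
  moreover have "fraction (\<lambda>s. A s x0) (\<lambda>s. B s x0)"
    unfolding fraction_def using polyA B0[OF V(2)] by (auto intro: zero_carrier_vec)
  ultimately have "\<exists>d p q. fraction p q \<and> degree_less n d q" by blast
  then have "\<exists>p q. fraction p q \<and> degree_less n d q" unfolding d_def by (rule LeastI_ex)
  then obtain p q where pq: "fraction p q" and deg_q: "degree_less n d q" by blast
  have p: "polyfun n p" and q: "polyfun n q"
    using pq deg_q degree_less_polyfun unfolding fraction_def by auto
  have pq_eq: "p s * B s x0 = q s * A s x0" if "s \<in> carrier_vec n" for s
    using pq that unfolding fraction_def by blast
  have "d \<noteq> 0"
  proof
    assume "d = 0"
    then have "q s = 0" for s using deg_q degree_less_0 by blast
    then show False using pq unfolding fraction_def by blast
  qed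
  then obtain e where d: "d = Suc e" using not0_implies_Suc by blast
  have minimal: "\<not> (fraction p' q' \<and> degree_less n e q')" for p' q'
    using not_less_Least[of e "\<lambda>d. \<exists>p q. fraction p q \<and> degree_less n d q"] d unfolding d_def by auto
  obtain c where deg_p: "degree_less n c p" using polyfun_degree_less[OF p] by blast
  \<comment> \<open>\<open>p / q\<close> at \<open>s + \<tau> u\<close> and \<open>A / B\<close> at \<open>(s, u)\<close> both are the value of \<open>F\<close> at
    \<open>\<alpha> s u = \<alpha> (s + \<tau> u) x0\<close>\<close>
  have translated: "p (s + \<tau> u) * B s u = q (s + \<tau> u) * A s u" if u: "u \<in> V" and s: "s \<in> carrier_vec n" for u s
  proof -
    let ?t = "\<tau> u"
    have t: "?t \<in> carrier_vec n" "- ?t \<in> carrier_vec n" using u V(3) \<tau>_carrier by auto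
    let ?I = "{r, \<lambda>s. r (s + ?t), \<lambda>s. B s u, \<lambda>s. B (s + ?t) x0}"
    have "\<exists>w. polyfun n w \<and> (\<exists>s\<in>carrier_vec n. w s \<noteq> 0) \<and> (\<forall>s. w s \<noteq> 0 \<longrightarrow> (\<forall>f\<in>?I. f s \<noteq> 0))"
    proof (rule polyfun_nonzero_all)
      show "polyfun n f" if "f \<in> ?I" for f
        using that r(1) polyB polyfun_translate[OF r(1) t(1)] polyfun_translate[OF polyB t(1)] by auto
      have "- ?t + ?t = 0\<^sub>v n" using t by simp
      then have "r (- ?t + ?t) \<noteq> 0" "B (- ?t + ?t) x0 \<noteq> 0" using r(2) B0[OF V(2)] by simp_all
      then show "\<exists>s\<in>carrier_vec n. f s \<noteq> 0" if "f \<in> ?I" for f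
        using that r(2) B0[OF u] t(2) zero_carrier_vec[of n] by blast
    qed simp
    then obtain w where w: "polyfun n w" "\<exists>s\<in>carrier_vec n. w s \<noteq> 0" "\<And>s. w s \<noteq> 0 \<Longrightarrow> \<forall>f\<in>?I. f s \<noteq> 0"
      by blast
    have "(\<lambda>s. p (s + ?t) * B s u) s = (\<lambda>s. q (s + ?t) * A s u) s"
    proof (rule polyfun_eqI[OF _ _ w(1,2) _ s])
      show "polyfun n (\<lambda>s. p (s + ?t) * B s u)" "polyfun n (\<lambda>s. q (s + ?t) * A s u)"
        using p q polyA polyB t by (auto intro: polyfun.mult polyfun_translate)
      fix s :: "'k vec" assume s: "s \<in> carrier_vec n" and "w s \<noteq> 0"
      then have nz: "r s \<noteq> 0" "r (s + ?t) \<noteq> 0" "B s u \<noteq> 0" "B (s + ?t) x0 \<noteq> 0" using w(3) by auto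
      have st: "s + ?t \<in> carrier_vec n" using s t by simp
      have "\<alpha> (s + ?t) x0 = \<alpha> s u"
        using action_add[OF s t(1) x0] orbit_map_\<tau> u V(3) by auto
      then have 1: "F (\<alpha> s u) * B (s + ?t) x0 = A (s + ?t) x0"
        using quot[OF V(2) st nz(2,4)] by simp
      have 2: "F (\<alpha> s u) * B s u = A s u" using quot[OF u s nz(1,3)] by simp
      have "p (s + ?t) * B (s + ?t) x0 = q (s + ?t) * (F (\<alpha> s u) * B (s + ?t) x0)"
        using pq_eq[OF st] 1 by simp
      then have "p (s + ?t) = q (s + ?t) * F (\<alpha> s u)" using nz(4) by simp
      then show "p (s + ?t) * B s u = q (s + ?t) * A s u" using 2 by (simp add: mult.assoc)
    qed
    then show ?thesis by simp
  qed
  obtain P :: "'k vec set" and l where Pl: "finite P" "P \<subseteq> carrier_vec n" "\<And>x. x \<in> P \<Longrightarrow> degree_less n c (l x)"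
    "\<And>x y. x \<in> P \<Longrightarrow> y \<in> P \<Longrightarrow> l x y = (if x = y then 1 else 0)"
    and repP: "\<And>f v. degree_less n c f \<Longrightarrow> v \<in> carrier_vec n \<Longrightarrow> f v = (\<Sum>x\<in>P. f x * l x v)"
    by (rule degree_less_interpolation[where n = n and d = c], rule that)
  obtain Q :: "'k vec set" and m where Qm: "finite Q" "Q \<subseteq> carrier_vec n" "\<And>x. x \<in> Q \<Longrightarrow> degree_less n e (m x)"
    "\<And>x y. x \<in> Q \<Longrightarrow> y \<in> Q \<Longrightarrow> m x y = (if x = y then 1 else 0)"
    and repQ: "\<And>f v. degree_less n e f \<Longrightarrow> v \<in> carrier_vec n \<Longrightarrow> f v = (\<Sum>x\<in>Q. f x * m x v)"
    by (rule degree_less_interpolation[where n = n and d = e], rule that)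
  have deltaP: "(\<Sum>x\<in>P. a x * l x y) = a y" if "y \<in> P" for a y
  proof -
    have "(\<Sum>x\<in>P. a x * l x y) = (\<Sum>x\<in>P. if x = y then a x else 0)"
      by (rule sum.cong) (use Pl(4) that in auto)
    then show ?thesis using that Pl(1) by (simp add: sum.delta)
  qed
  have deltaQ: "(\<Sum>x\<in>Q. a x * m x y) = a y" if "y \<in> Q" for a y
  proof -
    have "(\<Sum>x\<in>Q. a x * m x y) = (\<Sum>x\<in>Q. if x = y then a x else 0)"
      by (rule sum.cong) (use Qm(4) that in auto)
    then show ?thesis using that Qm(1) by (simp add: sum.delta)
  qed
  have exp_p: "p (s + \<tau> u) = (\<Sum>x\<in>P. p (x + \<tau> u) * l x s)" if "u \<in> V" "s \<in> carrier_vec n" for u s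
    using repP[OF degree_less_translate[OF deg_p \<tau>_carrier] that(2)] that V(3) by blast
  have exp_q: "q (s + \<tau> u) - q s = (\<Sum>x\<in>Q. (q (x + \<tau> u) - q x) * m x s)" if "u \<in> V" "s \<in> carrier_vec n" for u s
    using repQ[OF _ that(2), of "\<lambda>v. q (v + \<tau> u) - q v"] degree_less_difference[OF deg_q \<tau>_carrier[of u]] that V(3)
    by (auto simp: d)
  let ?y = "\<lambda>j u. case j of Inl x \<Rightarrow> p (x + \<tau> u) | Inr x \<Rightarrow> q (x + \<tau> u) - q x"
  let ?a = "\<lambda>s j u. case j of Inl x \<Rightarrow> l x s * B s u | Inr x \<Rightarrow> - m x s * A s u"
  have sum_split: "(\<Sum>j\<in>P <+> Q. ?a s j u * z j) =
      (\<Sum>x\<in>P. z (Inl x) * l x s) * B s u - (\<Sum>x\<in>Q. z (Inr x) * m x s) * A s u" for s u z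
    using Pl(1) Qm(1) by (simp add: sum.Plus sum_distrib_left sum_distrib_right sum_negf ac_simps)
  have "\<exists>W. openin (space_top X) W \<and> x0 \<in> W \<and> W \<subseteq> V \<and> (\<forall>j\<in>P <+> Q. ?y j \<in> reg X W)"
  proof (rule linear_system_regular[where E = "carrier_vec n" and a = ?a and b = "\<lambda>s u. q s * A s u"])
    show "finite (P <+> Q)" using Pl(1) Qm(1) by simp
    show "?a s j \<in> reg X V" if "s \<in> carrier_vec n" "j \<in> P <+> Q" for s j
      by (cases j) (simp_all only: sum.case, (intro reg_mult reg_const V(1) regA regB)+)
    show "(\<lambda>u. q s * A s u) \<in> reg X V" for s
      by (intro reg_mult reg_const V(1) regA)
    show "(\<Sum>j\<in>P <+> Q. ?a s j u * ?y j u) = q s * A s u" if s: "s \<in> carrier_vec n" and u: "u \<in> V" for s u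
    proof -
      have "(\<Sum>j\<in>P <+> Q. ?a s j u * ?y j u) = p (s + \<tau> u) * B s u - (q (s + \<tau> u) - q s) * A s u"
        unfolding sum_split exp_p[OF u s] exp_q[OF u s] by simp
      then show ?thesis using translated[OF u s] by (simp add: left_diff_distrib)
    qed
    show "z j = 0" if z: "\<And>s. s \<in> carrier_vec n \<Longrightarrow> (\<Sum>j\<in>P <+> Q. ?a s j x0 * z j) = 0" and j: "j \<in> P <+> Q" for z j
    proof -
      define p' where "p' s = (\<Sum>x\<in>P. z (Inl x) * l x s)" for s
      define q' where "q' s = (\<Sum>x\<in>Q. z (Inr x) * m x s)" for s
      have eq: "p' s * B s x0 = q' s * A s x0" if "s \<in> carrier_vec n" for s
        using z[OF that] unfolding sum_split p'_def q'_def by simp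
      have "degree_less n c p'" "degree_less n e q'"
        unfolding p'_def q'_def by (intro degree_less_sum degree_less_scale Pl(3) Qm(3); assumption)+
      then have p': "polyfun n p'" and "\<not> fraction p' q'"
        using minimal degree_less_polyfun by blast+
      then have q'0: "q' s = 0" if "s \<in> carrier_vec n" for s
        using eq that unfolding fraction_def by blast
      have p'0: "p' s = 0" if s: "s \<in> carrier_vec n" for s
        by (rule polyfun_eqI[OF p' polyfun.const polyB[of x0] _ _ s])
          (use eq q'0 B0[OF V(2)] in \<open>auto intro: zero_carrier_vec\<close>)
      show "z j = 0"
      proof (cases j)
        case (Inl x)
        then have "x \<in> P" using j by auto
        then show ?thesis using p'0[of x] Pl(2) deltaP[of x "\<lambda>x. z (Inl x)"] Inl unfolding p'_def by auto
      next
        case (Inr x)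
        then have "x \<in> Q" using j by auto
        then show ?thesis using q'0[of x] Qm(2) deltaQ[of x "\<lambda>x. z (Inr x)"] Inr unfolding q'_def by auto
      qed
    qed
  qed (rule V)+
  then obtain W where W: "openin (space_top X) W" "x0 \<in> W" "W \<subseteq> V" and reg: "\<And>j. j \<in> P <+> Q \<Longrightarrow> ?y j \<in> reg X W"
    by blast
  have regP: "(\<lambda>u. p (x + \<tau> u)) \<in> reg X W" if "x \<in> P" for x using reg[OF InlI[OF that]] by simp
  have regQ: "(\<lambda>u. q (x + \<tau> u) - q x) \<in> reg X W" if "x \<in> Q" for x using reg[OF InrI[OF that]] by simp
  have "p \<in> orbit_algebra"
  proof (rule orbit_algebraI[OF p W(1,2)])
    fix s :: "'k vec" assume s: "s \<in> carrier_vec n"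
    have "(\<lambda>u. \<Sum>x\<in>P. p (x + \<tau> u) * l x s) \<in> reg X W"
      by (intro reg_sum reg_mult reg_const regP W(1))
    then show "(\<lambda>u. p (s + \<tau> u)) \<in> reg X W"
      by (rule reg_cong[OF W(1)]) (use exp_p[OF _ s] W(3) in auto)
  qed (use V W in blast)
  moreover have "q \<in> orbit_algebra"
  proof (rule orbit_algebraI[OF q W(1,2)])
    fix s :: "'k vec" assume s: "s \<in> carrier_vec n"
    have "(\<lambda>u. q s + (\<Sum>x\<in>Q. (q (x + \<tau> u) - q x) * m x s)) \<in> reg X W"
      by (intro reg_add reg_sum reg_mult reg_const regQ W(1))
    moreover have "q s + (\<Sum>x\<in>Q. (q (x + \<tau> u) - q x) * m x s) = q (s + \<tau> u)" if "u \<in> W" for u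
      using exp_q[OF _ s, of u] that W(3) by (auto simp: algebra_simps)
    ultimately show "(\<lambda>u. q (s + \<tau> u)) \<in> reg X W"
      by (rule reg_cong[OF W(1)])
  qed (use V W in blast)
  moreover have "\<exists>w. polyfun n w \<and> (\<exists>s\<in>carrier_vec n. w s \<noteq> 0) \<and>
      (\<forall>s. w s \<noteq> 0 \<longrightarrow> (\<forall>f\<in>{r, \<lambda>s. B s x0, q}. f s \<noteq> 0))"
  proof (rule polyfun_nonzero_all)
    show "polyfun n f" if "f \<in> {r, \<lambda>s. B s x0, q}" for f
      using that r(1) polyB q by auto
    show "\<exists>s\<in>carrier_vec n. f s \<noteq> 0" if "f \<in> {r, \<lambda>s. B s x0, q}" for f
      using that r(2) B0[OF V(2)] pq zero_carrier_vec[of n] unfolding fraction_def by blast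
  qed simp
  then obtain w where w: "polyfun n w" "\<exists>s\<in>carrier_vec n. w s \<noteq> 0"
      "\<And>s. w s \<noteq> 0 \<Longrightarrow> \<forall>f\<in>{r, \<lambda>s. B s x0, q}. f s \<noteq> 0" by blast
  have "\<alpha> s x0 \<in> C \<and> q s \<noteq> 0 \<and> F (\<alpha> s x0) = p s / q s" if s: "s \<in> carrier_vec n" and "w s \<noteq> 0" for s
  proof -
    have nz: "r s \<noteq> 0" "B s x0 \<noteq> 0" "q s \<noteq> 0" using w(3)[OF \<open>w s \<noteq> 0\<close>] by auto
    have "p s * B s x0 = q s * (F (\<alpha> s x0) * B s x0)"
      using pq_eq[OF s] quot[OF V(2) s nz(1,2)] by simp
    then have "p s = q s * F (\<alpha> s x0)" using nz by simp
    then show ?thesis using nz quot[OF V(2) s nz(1,2)] by simp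
  qed
  ultimately show thesis using w(1,2) by (intro that[of p q w])
qed

lemma chart_coordinates:
  obtains C m F where "openin (space_top X) C" "x0 \<in> C" "\<And>j. j < (m::nat) \<Longrightarrow> F j \<in> reg X C"
    "\<And>x y. x \<in> C \<Longrightarrow> y \<in> C \<Longrightarrow> \<forall>j<m. F j x = F j y \<Longrightarrow> x = y"
proof -
  have "\<exists>\<U>. finite \<U> \<and> \<Union>\<U> = points X \<and> (\<forall>C\<in>\<U>. openin (space_top X) C \<and>
      (\<exists>m Z \<phi>. algebraic_set m Z \<and> isomorphism (open_subspace X C) (affine_structure m Z) \<phi>))"
    using variety unfolding irreducible_variety_def variety_def prevariety_def by (elim conjE)
  then obtain \<U> where \<U>: "\<Union>\<U> = points X" and charts: "\<forall>C\<in>\<U>. openin (space_top X) C \<and>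
      (\<exists>m Z \<phi>. algebraic_set m Z \<and> isomorphism (open_subspace X C) (affine_structure m Z) \<phi>)"
    by (elim exE conjE)
  obtain C where "C \<in> \<U>" and x0C: "x0 \<in> C" using x0 \<U> by blast
  from bspec[OF charts \<open>C \<in> \<U>\<close>] obtain m Z \<phi> where C: "openin (space_top X) C" and Z: "algebraic_set m Z"
    and iso: "isomorphism (open_subspace X C) (affine_structure m Z) \<phi>" by (elim exE conjE)
  have Zc: "Z \<subseteq> carrier_vec m" using Z unfolding algebraic_set_def zero_locus_def by blast
  have ptsZ: "points (affine_structure m Z) = Z"
    using Zc unfolding points_def affine_structure_def by (auto simp: topspace_zariski)
  have \<phi>: "morphism (open_subspace X C) (affine_structure m Z) \<phi>"
    using iso unfolding isomorphism_def by (elim conjE)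
  obtain \<psi> where \<psi>: "\<forall>x\<in>C. \<psi> (\<phi> x) = x"
    using iso unfolding isomorphism_def points_open_subspace[OF C] by (elim conjE exE)
  have inj: "x = y" if "x \<in> C" "y \<in> C" "\<phi> x = \<phi> y" for x y
    using bspec[OF \<psi> that(1)] bspec[OF \<psi> that(2)] that(3) by metis
  have \<phi>Z: "\<phi> x \<in> Z" if "x \<in> C" for x
    using morphism_in_points[OF \<phi>] that unfolding ptsZ points_open_subspace[OF C] by blast
  have o: "openin (space_top (affine_structure m Z)) Z"
    using openin_points[of "affine_structure m Z"] unfolding ptsZ .
  have coords: "(\<lambda>x. \<phi> x $ j) \<in> reg X C" if "j < m" for j
  proof -
    have "(\<lambda>v. v $ j) \<in> reg (affine_structure m Z) Z"
      unfolding affine_structure_def function_space.simps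
    proof (intro CollectI ballI exI conjI)
      show "openin (subtopology (zariski m) Z) Z" using o by (simp add: affine_structure_def)
      show "polyfun m (\<lambda>v. v $ j)" by (rule polyfun.coord[OF that])
      show "polyfun m (\<lambda>_. 1)" by (rule polyfun.const)
    qed auto
    from morphism_pullback[OF \<phi> o this] have "(\<lambda>x. \<phi> x $ j) \<in> reg X {x \<in> C. \<phi> x \<in> Z}"
      by (simp add: points_open_subspace[OF C])
    moreover have "{x \<in> C. \<phi> x \<in> Z} = C" using \<phi>Z by blast
    ultimately show ?thesis by simp
  qed
  have separate: "x = y" if "x \<in> C" "y \<in> C" "\<forall>j<m. \<phi> x $ j = \<phi> y $ j" for x y
  proof (rule inj[OF that(1,2)])
    have "\<phi> x \<in> carrier_vec m" "\<phi> y \<in> carrier_vec m"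
      using \<phi>Z[OF that(1)] \<phi>Z[OF that(2)] Zc by blast+
    then show "\<phi> x = \<phi> y" using that(3) by (intro eq_vecI) auto
  qed
  show thesis
    by (rule that[of C m "\<lambda>j x. \<phi> x $ j", OF C x0C coords separate])
qed

text \<open>A common period \<open>v\<close> of \<open>orbit_algebra\<close> is a period of the coordinates of the orbit map in a chart,
  at least at generic points \<open>s\<close>, so that \<open>s\<close> and \<open>s + v\<close> have the same image.\<close>

lemma orbit_algebra_periods:
  assumes v: "v \<in> carrier_vec n"
    and period: "\<And>h t. h \<in> orbit_algebra \<Longrightarrow> t \<in> carrier_vec n \<Longrightarrow> h (t + v) = h t"
  shows "v = 0\<^sub>v n"
proof -
  obtain C m F where C: "openin (space_top X) C" "x0 \<in> C" and F: "\<And>j. j < (m::nat) \<Longrightarrow> F j \<in> reg X C"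
    and inj: "\<And>x y. x \<in> C \<Longrightarrow> y \<in> C \<Longrightarrow> \<forall>j<m. F j x = F j y \<Longrightarrow> x = y"
    by (rule chart_coordinates, rule that)
  \<comment> \<open>a constant function is added to the coordinates to cover the case \<open>m = 0\<close>\<close>
  let ?F = "\<lambda>j. if j < m then F j else (\<lambda>_. 0)"
  have "\<exists>w. polyfun n w \<and> (\<exists>s\<in>carrier_vec n. w s \<noteq> 0) \<and> (\<forall>s\<in>carrier_vec n. w s \<noteq> 0 \<longrightarrow>
      \<alpha> s x0 \<in> C \<and> \<alpha> (s + v) x0 \<in> C \<and> ?F j (\<alpha> (s + v) x0) = ?F j (\<alpha> s x0))" for j
  proof -
    have "?F j \<in> reg X C" using F reg_const[OF C(1)] by simp
    obtain p q w where
      pq: "p \<in> orbit_algebra" "q \<in> orbit_algebra" and w: "polyfun n w" "\<exists>s\<in>carrier_vec n. w s \<noteq> 0"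
      and eq: "\<And>s. s \<in> carrier_vec n \<Longrightarrow> w s \<noteq> 0 \<Longrightarrow> \<alpha> s x0 \<in> C \<and> q s \<noteq> 0 \<and> ?F j (\<alpha> s x0) = p s / q s"
      by (rule coordinate_fraction[OF C \<open>?F j \<in> reg X C\<close>], rule that)
    obtain a where a: "a \<in> carrier_vec n" "w a \<noteq> 0" using w(2) by blast
    have "(a - v) + v = a" using a v by (intro eq_vecI) auto
    then have "w ((a - v) + v) \<noteq> 0" using a by simp
    moreover have "a - v \<in> carrier_vec n" using a v by simp
    ultimately obtain s where "s \<in> carrier_vec n" "w s \<noteq> 0" "w (s + v) \<noteq> 0"
      using polyfun_nonzero_both[OF w(1) polyfun_translate[OF w(1) v] a] by blast
    moreover have "\<alpha> s x0 \<in> C \<and> \<alpha> (s + v) x0 \<in> C \<and> ?F j (\<alpha> (s + v) x0) = ?F j (\<alpha> s x0)"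
      if s: "s \<in> carrier_vec n" and nz: "w s * w (s + v) \<noteq> 0" for s
    proof -
      have sv: "s + v \<in> carrier_vec n" using s v by simp
      have "w s \<noteq> 0" "w (s + v) \<noteq> 0" using nz by auto
      then show ?thesis
        using eq[OF s] eq[OF sv] period[OF pq(1) s] period[OF pq(2) s] by metis
    qed
    ultimately show ?thesis
      using polyfun.mult[OF w(1) polyfun_translate[OF w(1) v]]
      by (intro exI[of _ "\<lambda>s. w s * w (s + v)"] conjI ballI impI bexI[of _ s]) auto
  qed
  then obtain w where w: "\<And>j. polyfun n (w j)" "\<And>j. \<exists>s\<in>carrier_vec n. w j s \<noteq> 0"
    and eq: "\<And>j s. s \<in> carrier_vec n \<Longrightarrow> w j s \<noteq> 0 \<Longrightarrow>
      \<alpha> s x0 \<in> C \<and> \<alpha> (s + v) x0 \<in> C \<and> ?F j (\<alpha> (s + v) x0) = ?F j (\<alpha> s x0)" by metis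
  obtain s where s: "s \<in> carrier_vec n" "\<And>j. j \<le> m \<Longrightarrow> w j s \<noteq> 0"
    using polyfun_nonzero_all[of "{..m}" n w] w by blast
  have "\<alpha> (s + v) x0 = \<alpha> s x0"
  proof (rule inj)
    show "\<alpha> (s + v) x0 \<in> C" "\<alpha> s x0 \<in> C" using eq[OF s(1) s(2)[of m]] by simp_all
    show "\<forall>j<m. F j (\<alpha> (s + v) x0) = F j (\<alpha> s x0)"
    proof (intro allI impI)
      fix j assume "j < m"
      then show "F j (\<alpha> (s + v) x0) = F j (\<alpha> s x0)" using eq[OF s(1) s(2)[of j]] by simp
    qed
  qed
  then have "s + v = s" using s v by (intro orbit_map_inj) auto
  then have "(s + v) $ i = s $ i" for i by simp
  then have "v $ i = 0" if "i < n" for i using that v by (metis add_cancel_right_right carrier_vecD index_add_vec(1))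
  then show ?thesis using v by (intro eq_vecI) auto
qed

lemma \<tau>_coordinate_regular:
  assumes i: "i < n"
  shows "(\<lambda>u. \<tau> u $ i) \<in> reg X U"
proof -
  have "\<exists>h\<in>orbit_algebra. \<forall>v\<in>carrier_vec n. h v = v $ i"
  proof (rule translation_invariant_algebra_coordinates[OF _ _ _ _ _ _ i])
    show "(\<lambda>v. h (v + g)) \<in> orbit_algebra" if h: "h \<in> orbit_algebra" and g: "g \<in> carrier_vec n" for h g
    proof -
      have "(\<lambda>u. h (\<tau> (\<alpha> g u))) \<in> reg X {u \<in> points X. \<alpha> g u \<in> U}"
        using morphism_pullback[OF translation_morphism[OF g] U, of "\<lambda>u. h (\<tau> u)"] h
        unfolding orbit_algebra_def by blast
      then have "(\<lambda>u. h (\<tau> (\<alpha> g u))) \<in> reg X U"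
        using reg_restrict[OF morphism_preimage[OF translation_morphism[OF g] U] U] action_U[OF g] U_sub by blast
      moreover have "h (\<tau> (\<alpha> g u)) = h (\<tau> u + g)" if "u \<in> U" for u
        using \<tau>_action[OF g that] comm_add_vec[OF g \<tau>_carrier[OF that]] by simp
      ultimately have "(\<lambda>u. h (\<tau> u + g)) \<in> reg X U" by (rule reg_cong[OF U])
      then show ?thesis using h polyfun_translate[OF _ g] unfolding orbit_algebra_def by blast
    qed
    show "v = 0\<^sub>v n" if "v \<in> carrier_vec n"
      "\<And>h t. h \<in> orbit_algebra \<Longrightarrow> t \<in> carrier_vec n \<Longrightarrow> h (t + v) = h t" for v
      by (rule orbit_algebra_periods[OF that])
    show "(\<lambda>v. f v + h v) \<in> orbit_algebra" "(\<lambda>v. f v * h v) \<in> orbit_algebra"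
      if "f \<in> orbit_algebra" "h \<in> orbit_algebra" for f h
      using that reg_add[OF U] reg_mult[OF U] unfolding orbit_algebra_def by (auto intro: polyfun.add polyfun.mult)
    show "(\<lambda>_. c) \<in> orbit_algebra" for c
      unfolding orbit_algebra_def by (simp add: polyfun.const reg_const[OF U])
  qed (simp add: orbit_algebra_def)
  then obtain h where h: "(\<lambda>u. h (\<tau> u)) \<in> reg X U" "\<And>v. v \<in> carrier_vec n \<Longrightarrow> h v = v $ i"
    unfolding orbit_algebra_def by blast
  show ?thesis by (rule reg_cong[OF U h(1)]) (use h(2) \<tau>_carrier in blast)
qed

lemma \<tau>_morphism: "morphism (open_subspace X U) (affine_space n) \<tau>"
proof -
  interpret S: space_with_functions "open_subspace X U"
    by (rule space_with_functions_open_subspace[OF U])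
  show ?thesis
    by (rule S.morphism_affine_spaceI)
      (simp_all add: points_open_subspace[OF U] \<tau>_carrier \<tau>_coordinate_regular)
qed

lemma orbit_map_morphism:
  assumes Y: "space_with_functions Y" and t: "morphism Y (affine_space n) t"
  shows "morphism Y (open_subspace X U) (\<lambda>y. \<alpha> (t y) x0)"
proof (rule morphism_into_open_subspace[OF U])
  interpret Y: space_with_functions Y by fact
  show "morphism Y X (\<lambda>y. \<alpha> (t y) x0)"
    by (rule action_morphism[OF Y t Y.morphism_const[OF x0]])
  show "\<alpha> (t y) x0 \<in> U" if "y \<in> points Y" for y
    using morphism_in_points[OF t that] unfolding points_affine_space orbit by blast
qed

end

section \<open>Conjugacy\<close>

lemma additive_orbit_openI:
  fixes X :: "('p, 'k :: field_char_0) function_space"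
  assumes X: "irreducible_variety X" and action: "additive_action n X \<alpha>" and U: "open_orbit n X \<alpha> U"
  obtains x0 where "additive_orbit X n \<alpha> x0 U"
proof -
  obtain x0 where x0: "x0 \<in> points X" "U = orbit (Ga TYPE('k) n) \<alpha> x0"
    using U unfolding open_orbit_def orbits_def by blast
  have "additive_orbit X n \<alpha> x0 U"
  proof (intro additive_orbit.intro additive_orbit_axioms.intro)
    show "space_with_functions X"
      using X unfolding irreducible_variety_def variety_def prevariety_def by blast
    show "U = {\<alpha> g x0 | g. g \<in> carrier_vec n}"
      using x0(2) unfolding Group_Action.orbit_def monoid_vec_simps by simp
    show "openin (space_top X) U" using U unfolding open_orbit_def by blast
  qed (rule assms x0)+
  then show thesis by (rule that)
qed

locale two_additive_orbits =
  A: additive_orbit X n \<alpha> x0 U + B: additive_orbit X n \<beta> y0 V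
  for X :: "('p, 'k :: field_char_0) function_space" and n \<alpha> x0 U \<beta> y0 V
begin

text \<open>The map \<open>\<alpha> g x0 \<mapsto> \<beta> g y0\<close>.\<close>

definition conjugation :: "'p \<Rightarrow> 'p" where
  "conjugation u = \<beta> (A.\<tau> u) y0"

lemma conjugation_morphism: "morphism (open_subspace X U) (open_subspace X V) conjugation"
  unfolding conjugation_def
  by (rule B.orbit_map_morphism[OF A.space_with_functions_open_subspace[OF A.U] A.\<tau>_morphism])

lemma conjugation_in_V: "u \<in> U \<Longrightarrow> conjugation u \<in> V"
  using morphism_in_points[OF conjugation_morphism]
  by (simp add: points_open_subspace[OF A.U] points_open_subspace[OF B.U])

lemma \<tau>_conjugation: "u \<in> U \<Longrightarrow> B.\<tau> (conjugation u) = A.\<tau> u"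
  unfolding conjugation_def by (rule B.\<tau>_orbit_map[OF A.\<tau>_carrier])

lemma conjugation_equivariant:
  assumes "g \<in> carrier_vec n" "u \<in> U"
  shows "conjugation (\<alpha> g u) = \<beta> g (conjugation u)"
  unfolding conjugation_def A.\<tau>_action[OF assms]
  by (rule B.action_add[OF assms(1) A.\<tau>_carrier[OF assms(2)] B.x0])

lemma conjugation_rational_map: "rational_map X X (U, conjugation)"
proof -
  have "morphism (open_subspace X U) X conjugation"
    unfolding conjugation_def
    using A.space_with_functions_open_subspace[OF A.U]
    by (rule B.action_morphism[OF _ A.\<tau>_morphism space_with_functions.morphism_const[OF _ B.x0]])
      (rule A.space_with_functions_open_subspace[OF A.U])
  then show ?thesis using A.U A.x0_U unfolding rational_map_def by auto
qed

text \<open>Stated without the map of the opposite direction, which becomes available by exchanging the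
  two actions.\<close>

lemma conjugation_left_inverse: "u \<in> U \<Longrightarrow> \<alpha> (B.\<tau> (conjugation u)) x0 = u"
  by (simp add: \<tau>_conjugation A.orbit_map_\<tau>)

lemma closure_V: "Abstract_Topology.closure_of (space_top X) V = points X"
proof -
  let ?A = "Abstract_Topology.closure_of (space_top X) V" and ?B = "topspace (space_top X) - V"
  have "closedin (space_top X) ?A" "closedin (space_top X) ?B" using B.U by auto
  moreover have "?A \<union> ?B = topspace (space_top X)"
    using closure_of_subset[OF openin_subset[OF B.U]] closure_of_subset_topspace[of "space_top X" V] by blast
  ultimately have "?A = topspace (space_top X) \<or> ?B = topspace (space_top X)"
    using A.variety unfolding irreducible_variety_def irreducible_space_def by blast
  then show ?thesis using B.x0_U B.U_sub unfolding points_def by blast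
qed

end

sublocale two_additive_orbits \<subseteq> swap: two_additive_orbits X n \<beta> y0 V \<alpha> x0 U
  by (intro two_additive_orbits.intro A.additive_orbit_axioms B.additive_orbit_axioms)

context two_additive_orbits
begin

lemma swap_conjugation:
  "u \<in> U \<Longrightarrow> swap.conjugation (conjugation u) = u"
  "v \<in> V \<Longrightarrow> conjugation (swap.conjugation v) = v"
  using conjugation_left_inverse swap.conjugation_left_inverse
  unfolding conjugation_def swap.conjugation_def by blast+

lemma conjugation_image: "conjugation ` U = V" "swap.conjugation ` V = U"
  using conjugation_in_V swap.conjugation_in_V swap_conjugation by (force intro: rev_image_eqI)+

lemma conjugate_in_Bir: "conjugate_in_Bir n X \<alpha> \<beta>"
  unfolding conjugate_in_Bir_def
proof (intro bexI[of _ "(U, conjugation)"] ballI)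
  have "dominant X (U, conjugation)" "dominant X (V, swap.conjugation)"
    unfolding dominant_def by (simp_all add: conjugation_image closure_V swap.closure_V)
  moreover have "rat_eq X (rat_comp (V, swap.conjugation) (U, conjugation)) (rat_of X (\<lambda>x. x))"
    unfolding rat_eq_def rat_comp_def rat_of_def
    using A.U A.x0_U A.U_sub conjugation_in_V swap_conjugation by (intro exI[of _ U]) auto
  moreover have "rat_eq X (rat_comp (U, conjugation) (V, swap.conjugation)) (rat_of X (\<lambda>x. x))"
    unfolding rat_eq_def rat_comp_def rat_of_def
    using B.U B.x0_U B.U_sub swap.conjugation_in_V swap_conjugation by (intro exI[of _ V]) auto
  ultimately show "(U, conjugation) \<in> Bir X"
    unfolding Bir_def using conjugation_rational_map swap.conjugation_rational_map by blast
  fix g assume "g \<in> carrier (Ga TYPE('k) n)"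
  then have g: "g \<in> carrier_vec n" by (simp add: monoid_vec_simps)
  show "rat_eq X (rat_comp (U, conjugation) (rat_of X (\<alpha> g))) (rat_comp (rat_of X (\<beta> g)) (U, conjugation))"
    unfolding rat_eq_def rat_comp_def rat_of_def
    using A.U A.x0_U A.U_sub A.action_U[OF g] conjugation_in_V B.U_sub conjugation_equivariant[OF g]
    by (intro exI[of _ U]) auto
qed

lemma conjugate_in_Aut:
  assumes "U = V"
  shows "conjugate_in_Aut n X U \<alpha> \<beta>"
  unfolding conjugate_in_Aut_def
proof (intro bexI[of _ conjugation] ballI)
  have "morphism (open_subspace X U) (open_subspace X U) conjugation"
    "morphism (open_subspace X U) (open_subspace X U) swap.conjugation"
    using conjugation_morphism swap.conjugation_morphism assms by simp_all
  moreover have "\<forall>x\<in>U. swap.conjugation (conjugation x) = x" "\<forall>x\<in>U. conjugation (swap.conjugation x) = x"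
    using swap_conjugation assms by simp_all
  ultimately show "conjugation \<in> Aut (open_subspace X U)"
    unfolding Aut_def isomorphism_def points_open_subspace[OF A.U] by blast
qed (simp add: monoid_vec_simps conjugation_equivariant)

end

theorem proposition1:
  fixes X :: "('p, 'k :: {alg_closed_field, field_char_0}) function_space"
    and n :: nat
    and \<alpha> \<beta> :: "'k vec \<Rightarrow> 'p \<Rightarrow> 'p"
  assumes "irreducible_variety X"
    and "additive_action n X \<alpha>"
    and "additive_action n X \<beta>"
  shows "conjugate_in_Bir n X \<alpha> \<beta> \<and>
         (\<forall>U. open_orbit n X \<alpha> U \<and> open_orbit n X \<beta> U \<longrightarrow> conjugate_in_Aut n X U \<alpha> \<beta>)"
proof (intro conjI allI impI)
  obtain U V where UV: "open_orbit n X \<alpha> U" "open_orbit n X \<beta> V"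
    using assms(2,3) unfolding additive_action_def by blast
  obtain x0 where x0: "additive_orbit X n \<alpha> x0 U" by (rule additive_orbit_openI[OF assms(1,2) UV(1)])
  obtain y0 where y0: "additive_orbit X n \<beta> y0 V" by (rule additive_orbit_openI[OF assms(1,3) UV(2)])
  show "conjugate_in_Bir n X \<alpha> \<beta>"
    by (rule two_additive_orbits.conjugate_in_Bir[OF two_additive_orbits.intro[OF x0 y0]])
next
  fix U assume U: "open_orbit n X \<alpha> U \<and> open_orbit n X \<beta> U"
  obtain x0 where x0: "additive_orbit X n \<alpha> x0 U"
    by (rule additive_orbit_openI[OF assms(1,2) conjunct1[OF U]])
  obtain y0 where y0: "additive_orbit X n \<beta> y0 U"
    by (rule additive_orbit_openI[OF assms(1,3) conjunct2[OF U]])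
  show "conjugate_in_Aut n X U \<alpha> \<beta>"
    by (rule two_additive_orbits.conjugate_in_Aut[OF two_additive_orbits.intro[OF x0 y0] refl])
qed

end
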